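(* For every $d\ge 1$, $T_{2d}^{(1)}\supseteq\operatorname{trop}(\mathcal{B}\Sigma_{2d}^* )\supseteq T_{2d}^{(2)}$.
   Context: Let $\Lambda_{2d}^{\varepsilon}$ be the set of partitions of $2d$ all of whose parts are even; its cardinality is $\pi(d)$, the number of partitions of $d$, and coordinates of $\mathbb{R}^{\pi(d)}$ are indexed by $\Lambda_{2d}^\varepsilon$. For a partition $\lambda$ with $\ell(\lambda)$ parts write $\lambda_{(1)}\le\cdots\le\lambda_{(\ell(\lambda))}$ for its parts in increasing order. Superdominance order: for partitions $\lambda,\mu$ of the same integer, $\lambda\succeq\mu$ means $\sum_{i=1}^{j}\lambda_{(i)}\le\sum_{i=1}^{j}\mu_{(i)}$ for each $j=1,\dots,\min\{\ell(\lambda),\ell(\mu)\}$. The fusion $\lambda^1\cdots\lambda^k$ of partitions is the partition whose parts are the parts of all the $\lambda^i$ put together (with multiplicity); $\mu^{\circ k}$ is the fusion of $k$ copies of $\mu$. For $k\ge1$, $T_{2d}^{(k)}\subset\mathbb{R}^{\pi(d)}$ is the set of $y$ satisfying $y_{\lambda^1}+\cdots+y_{\lambda^k}\ge k\,y_\mu$ for all $\lambda^1,\dots,\lambda^k,\mu\in\Lambda_{2d}^\varepsilon$ with $\lambda^1\cdots\lambda^k\succeq\mu^{\circ k}$. For a partition $\lambda$, $p_\lambda=\prod_i p_{\lambda_i}$ with $p_r=X_1^r+\cdots+X_n^r$. $\mathcal{B}\Sigma_{2d}$ is the set of $c\in\mathbb{R}^{\Lambda_{2d}^\varepsilon}$ such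 that for every $n\ge2d$ the form $\sum_\lambda c_\lambda p_\lambda(X_1,\dots,X_n)$ is a sum of squares of real polynomials. Its dual cone is $\mathcal{B}\Sigma_{2d}^*=\{\varphi\in\mathbb{R}^{\Lambda_{2d}^\varepsilon}:\sum_\lambda c_\lambda\varphi_\lambda\ge0\ \text{for all } c\in\mathcal{B}\Sigma_{2d}\}$, which lies in the nonnegative orthant. For $S\subset\mathbb{R}_{\ge0}^s$, $\operatorname{trop}(S)=\lim_{t\to\infty}\log_t(S\cap\mathbb{R}_{>0}^s)$ with $\log_t$ applied coordinatewise; equivalently $y\in\operatorname{trop}(S)$ iff there are sequences $x^{(m)}\in S\cap\mathbb{R}_{>0}^s$ and $\tau_m\in(0,1)$ with $\tau_m\to0$ and $y=\lim_{m\to\infty}\log_{1/\tau_m}(x^{(m)})$. *)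

theory Defs
  imports
    "HOL-Analysis.Analysis"
    "HOL-Library.Multiset"
    "HOL-Library.FuncSet"
    "HOL-Library.Poly_Mapping"
begin

text \<open>
  A partition is the multiset of its parts. For an index set \<open>I\<close>, the real coordinate space
  indexed by \<open>I\<close> is \<open>I \<rightarrow>\<^sub>E UNIV\<close>, whose elements are determined by their coordinates
  in \<open>I\<close>.
\<close>

definition partitions :: "nat \<Rightarrow> nat multiset set" where
  "partitions N = {\<mu>. sum_mset \<mu> = N \<and> 0 \<notin># \<mu>}"

definition even_partitions :: "nat \<Rightarrow> nat multiset set" where
  "even_partitions N = {\<mu> \<in> partitions N. \<forall>r \<in># \<mu>. even r}"

lemma finite_partitions: "finite (partitions N)"
proof -
  have "partitions N \<subseteq> mset ` {xs. set xs \<subseteq> {..N} \<and> length xs \<le> N}"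
  proof
    fix \<mu> assume \<mu>: "\<mu> \<in> partitions N"
    obtain xs where xs: "mset xs = \<mu>" using ex_mset by blast
    have s: "sum_list xs = N" and z: "0 \<notin> set xs"
      using \<mu> unfolding partitions_def xs[symmetric] by (auto simp: sum_mset_sum_list)
    have "length xs \<le> sum_list xs" using z by (induction xs) auto
    moreover have "set xs \<subseteq> {..N}" using s member_le_sum_list by fastforce
    ultimately show "\<mu> \<in> mset ` {xs. set xs \<subseteq> {..N} \<and> length xs \<le> N}"
      using xs s by auto
  qed
  thus ?thesis
    by (rule finite_subset) (simp add: finite_lists_length_le)
qed

lemma finite_even_partitions: "finite (even_partitions N)"
  using finite_partitions by (simp add: even_partitions_def)

definition superdom :: "nat multiset \<Rightarrow> nat multiset \<Rightarrow> bool" (infix \<open>\<succeq>\<^sub>s\<close> 50) where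
  "\<nu> \<succeq>\<^sub>s \<mu> \<longleftrightarrow>
     sum_mset \<nu> = sum_mset \<mu> \<and>
     (\<forall>j \<in> {1..min (size \<nu>) (size \<mu>)}.
        sum_list (take j (sorted_list_of_multiset \<nu>))
          \<le> sum_list (take j (sorted_list_of_multiset \<mu>)))"

text \<open>
  Fusion of partitions is addition of multisets.
\<close>

definition T_cone :: "nat \<Rightarrow> nat \<Rightarrow> (nat multiset \<Rightarrow> real) set" where
  "T_cone k N =
     {y \<in> even_partitions N \<rightarrow>\<^sub>E UNIV.
        \<forall>\<nu> \<in> {1..k} \<rightarrow> even_partitions N. \<forall>\<mu> \<in> even_partitions N.
          (\<Sum>i = 1..k. \<nu> i) \<succeq>\<^sub>s repeat_mset k \<mu> \<longrightarrow>
          (\<Sum>i = 1..k. y (\<nu> i)) \<ge> real k * y \<mu>}"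

text \<open>
  Real polynomials in the variables \<open>X\<^sub>1, X\<^sub>2, \<dots>\<close> are finitely supported functions from
  exponent vectors to coefficients; multiplication on \<^typ>\<open>'a \<Rightarrow>\<^sub>0 'b\<close> is convolution.
\<close>

type_synonym rpoly = "(nat \<Rightarrow>\<^sub>0 nat) \<Rightarrow>\<^sub>0 real"

definition Const :: "real \<Rightarrow> rpoly" where
  "Const c = Poly_Mapping.single 0 c"

definition Var :: "nat \<Rightarrow> rpoly" where
  "Var i = Poly_Mapping.single (Poly_Mapping.single i 1) 1"

definition polys_in :: "nat \<Rightarrow> rpoly set" where
  "polys_in n = {q. \<forall>e \<in> Poly_Mapping.keys q. Poly_Mapping.keys e \<subseteq> {1..n}}"

definition sum_of_squares :: "nat \<Rightarrow> rpoly \<Rightarrow> bool" where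
  "sum_of_squares n f \<longleftrightarrow>
     (\<exists>qs. set qs \<subseteq> polys_in n \<and> f = (\<Sum>q\<leftarrow>qs. q ^ 2))"

definition power_sum :: "nat \<Rightarrow> nat \<Rightarrow> rpoly" where
  "power_sum n r = (\<Sum>i = 1..n. Var i ^ r)"

definition power_sum_partition :: "nat \<Rightarrow> nat multiset \<Rightarrow> rpoly" where
  "power_sum_partition n \<mu> = (\<Prod>r \<in># \<mu>. power_sum n r)"

definition B_Sigma :: "nat \<Rightarrow> (nat multiset \<Rightarrow> real) set" where
  "B_Sigma N =
     {c \<in> even_partitions N \<rightarrow>\<^sub>E UNIV.
        \<forall>n \<ge> N. sum_of_squares n
          (\<Sum>\<mu> \<in> even_partitions N. Const (c \<mu>) * power_sum_partition n \<mu>)}"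

definition dual_cone :: "'i set \<Rightarrow> ('i \<Rightarrow> real) set \<Rightarrow> ('i \<Rightarrow> real) set" where
  "dual_cone I C = {\<phi> \<in> I \<rightarrow>\<^sub>E UNIV. \<forall>c \<in> C. (\<Sum>i \<in> I. c i * \<phi> i) \<ge> 0}"

text \<open>
  The limit of \<open>log\<^sub>t (S \<inter> \<real>\<^sub>>\<^sub>0\<^sup>I)\<close> as \<open>t \<rightarrow> \<infinity>\<close>, expressed by sequences with base \<open>t = 1 / \<tau> m\<close>.
\<close>

definition trop :: "'i set \<Rightarrow> ('i \<Rightarrow> real) set \<Rightarrow> ('i \<Rightarrow> real) set" where
  "trop I S =
     {y \<in> I \<rightarrow>\<^sub>E UNIV.
        \<exists>(x :: nat \<Rightarrow> 'i \<Rightarrow> real) (\<tau> :: nat \<Rightarrow> real).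
          (\<forall>m. x m \<in> S \<and> (\<forall>i \<in> I. x m i > 0)) \<and>
          (\<forall>m. 0 < \<tau> m \<and> \<tau> m < 1) \<and> \<tau> \<longlonglongrightarrow> 0 \<and>
          (\<forall>i \<in> I. (\<lambda>m. log (1 / \<tau> m) (x m i)) \<longlonglongrightarrow> y i)}"

end

theory Submission
  imports Defs
begin

text \<open>
  If \<open>\<nu> \<succeq> \<mu>\<close>, then \<open>p\<^sub>\<nu> - p\<^sub>\<mu>\<close> is a sum of squares, by merging parts and
  by transfers between two parts; this gives the first inclusion.

  For the second one, let \<open>g\<close> be the exponential of a point of \<open>T\<^sup>(\<^sup>2\<^sup>)\<close>, slightly perturbed to
  make its inequalities strict, and give the even monomial \<open>X\<^sup>e\<close> of degree \<open>2d\<close> the value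
  \<open>g(e) / n\<^sup>s\<close>, where \<open>s\<close> is the number of variables in \<open>X\<^sup>e\<close> and \<open>g\<close> is evaluated at the
  partition formed by the exponents. This functional sends \<open>p\<^sub>\<mu>\<close> to \<open>g(\<mu>)\<close> up to a bounded factor.
  Its Gram matrix has large off-diagonal entries, but inclusion-exclusion over the set of variables
  common to two monomials writes it as a sum over sets \<open>K\<close> of variables of pullbacks of Gram matrices
  of a size independent of \<open>n\<close>: a monomial is remembered only through its exponents on \<open>K\<close> and the
  multiset of its other exponents. As \<open>n \<rightarrow> \<infinity>\<close> these matrices tend to
  \<open>(g(\<nu> \<union> \<nu>' \<union> (\<alpha> + \<beta>)))\<close>, which is diagonally dominant because of the inequalities defining
  \<open>T\<^sup>(\<^sup>2\<^sup>)\<close>.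
\<close>

section \<open>Superdominance and sub-multisets\<close>

text \<open>Removing from \<open>A\<close> a part that is at least the head \<open>x\<close>, with
  the rest of \<open>A\<close> inside \<open>ys\<close>, reduces the claim to
  \<open>ys\<close>.\<close>

lemma sum_list_take_sorted_le:
  fixes xs :: "nat list"
  assumes "sorted xs" and "A \<subseteq># mset xs"
  shows "sum_list (take (size A) xs) \<le> sum_mset A"
  using assms
proof (induction xs arbitrary: A)
  case Nil
  then show ?case by simp
next
  case (Cons x ys)
  show ?case
  proof (cases "A = {#}")
    case False
    \<comment> \<open>This is \<open>x\<close> itself if it occurs in \<open>A\<close>; otherwise
      \<open>A\<close> already lies in \<open>ys\<close>, and any part of it is at least
      \<open>x\<close>.\<close>
    obtain a where a: "a \<in># A" "x \<le> a" "A - {#a#} \<subseteq># mset ys"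
    proof (cases "x \<in># A")
      case True
      with Cons.prems show ?thesis
        using that[of x] by (simp add: subset_eq_diff_conv)
    next
      case x: False
      have "A - {#x#} \<subseteq># mset ys" using Cons.prems by (simp add: subset_eq_diff_conv)
      with x have A: "A \<subseteq># mset ys" by (simp add: diff_single_trivial)
      from False obtain a where a: "a \<in># A" by blast
      then have "a \<in> set ys" using A by (auto dest: mset_subset_eqD)
      moreover have "A - {#a#} \<subseteq># mset ys"
        using A by (meson diff_subset_eq_self subset_mset.order_trans)
      ultimately show ?thesis using that[of a] a Cons.prems by auto
    qed
    have "sum_list (take (size (A - {#a#})) ys) \<le> sum_mset (A - {#a#})"
      using Cons.IH a(3) Cons.prems by simp
    moreover have "size A = Suc (size (A - {#a#}))"
      using a(1) by (simp add: size_Suc_Diff1)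
    moreover have "sum_mset A = a + sum_mset (A - {#a#})"
      using a(1) by (rule sum_mset.remove)
    ultimately show ?thesis using a(2) by simp
  qed simp
qed

text \<open>Superdominance without sorting: an initial sum of the sorted parts is the least sum over
  sub-multisets of that size. In this form the relation passes to fusions. The choice
  \<open>B = \<mu>\<close> also forces \<open>\<nu>\<close> to have at least as many parts as
  \<open>\<mu>\<close>.\<close>

definition sub_dom :: "nat multiset \<Rightarrow> nat multiset \<Rightarrow> bool" where
  "sub_dom \<nu> \<mu> \<longleftrightarrow> sum_mset \<nu> = sum_mset \<mu> \<and>
     (\<forall>B. B \<subseteq># \<mu> \<longrightarrow> (\<exists>A. A \<subseteq># \<nu> \<and> size A = size B \<and> sum_mset A \<le> sum_mset B))"

lemma sub_dom_imp_superdom: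
  assumes "sub_dom \<nu> \<mu>"
  shows "\<nu> \<succeq>\<^sub>s \<mu>"
  unfolding superdom_def
proof (intro conjI ballI)
  show "sum_mset \<nu> = sum_mset \<mu>" using assms by (simp add: sub_dom_def)
next
  fix j assume j: "j \<in> {1..min (size \<nu>) (size \<mu>)}"
  let ?B = "mset (take j (sorted_list_of_multiset \<mu>))"
  have "size (sorted_list_of_multiset \<mu>) = size \<mu>"
    by (metis mset_sorted_list_of_multiset size_mset)
  then have sB: "size ?B = j" using j by simp
  have "?B \<subseteq># \<mu>"
    by (metis append_take_drop_id mset_append mset_sorted_list_of_multiset mset_subset_eq_add_left)
  then obtain A where A: "A \<subseteq># \<nu>" "size A = j" "sum_mset A \<le> sum_mset ?B"
    using assms sB by (auto simp: sub_dom_def)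
  have "sum_list (take j (sorted_list_of_multiset \<nu>)) \<le> sum_mset A"
    using sum_list_take_sorted_le[of "sorted_list_of_multiset \<nu>" A] A by simp
  also have "\<dots> \<le> sum_list (take j (sorted_list_of_multiset \<mu>))"
    using A(3) by (simp add: sum_mset_sum_list)
  finally show "sum_list (take j (sorted_list_of_multiset \<nu>))
      \<le> sum_list (take j (sorted_list_of_multiset \<mu>))" .
qed

lemma sub_dom_refl: "sub_dom \<mu> \<mu>"
  by (auto simp: sub_dom_def)

text \<open>A sub-multiset \<open>B\<close> of the fusion splits into
  \<open>B \<inter># \<mu>\<^sub>1\<close> and \<open>B - \<mu>\<^sub>1\<close>, which lies in
  \<open>\<mu>\<^sub>2\<close>; the two pieces are matched separately.\<close>

lemma sub_dom_add:
  assumes "sub_dom \<nu>\<^sub>1 \<mu>\<^sub>1" and "sub_dom \<nu>\<^sub>2 \<mu>\<^sub>2"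
  shows "sub_dom (\<nu>\<^sub>1 + \<nu>\<^sub>2) (\<mu>\<^sub>1 + \<mu>\<^sub>2)"
  unfolding sub_dom_def
proof (intro conjI allI impI)
  show "sum_mset (\<nu>\<^sub>1 + \<nu>\<^sub>2) = sum_mset (\<mu>\<^sub>1 + \<mu>\<^sub>2)" using assms by (simp add: sub_dom_def)
next
  fix B assume B: "B \<subseteq># \<mu>\<^sub>1 + \<mu>\<^sub>2"
  obtain A1 where A1: "A1 \<subseteq># \<nu>\<^sub>1" "size A1 = size (B \<inter># \<mu>\<^sub>1)" "sum_mset A1 \<le> sum_mset (B \<inter># \<mu>\<^sub>1)"
    using assms(1) unfolding sub_dom_def by (meson subset_mset.inf_le2)
  have "B - \<mu>\<^sub>1 \<subseteq># \<mu>\<^sub>2" using B by (simp add: subset_eq_diff_conv add.commute)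
  then obtain A2 where A2: "A2 \<subseteq># \<nu>\<^sub>2" "size A2 = size (B - \<mu>\<^sub>1)" "sum_mset A2 \<le> sum_mset (B - \<mu>\<^sub>1)"
    using assms(2) unfolding sub_dom_def by meson
  have "B = (B \<inter># \<mu>\<^sub>1) + (B - \<mu>\<^sub>1)" by (auto simp: multiset_eq_iff min_def)
  then have "size (A1 + A2) = size B" "sum_mset (A1 + A2) \<le> sum_mset B"
    using A1 A2 by (metis size_union, metis add_mono sum_mset.union)
  then show "\<exists>A. A \<subseteq># \<nu>\<^sub>1 + \<nu>\<^sub>2 \<and> size A = size B \<and> sum_mset A \<le> sum_mset B"
    using A1(1) A2(1) by (meson subset_mset.add_mono)
qed

lemma sub_dom_merge: "sub_dom {#a, b#} {#a + b#}"
proof -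
  have "\<exists>A. A \<subseteq># {#a, b#} \<and> size A = size B \<and> sum_mset A \<le> sum_mset B"
    if "B \<subseteq># {#a + b#}" for B
  proof -
    from that consider "B = {#}" | "B = {#a + b#}"
      by (metis mset_subset_eq_single subset_mset.le_less subset_mset.less_eqE empty_iff
          union_is_single)
    then show ?thesis
    proof cases
      case 1 then show ?thesis by auto
    next
      case 2 then show ?thesis by (intro exI[of _ "{#a#}"]) auto
    qed
  qed
  then show ?thesis by (simp add: sub_dom_def)
qed

text \<open>A single part \<open>a + b\<close> is matched with the smaller of \<open>2 * a\<close>
  and \<open>2 * b\<close>. Such parts come from a variable shared by two monomials with exponents
  \<open>a\<close> and \<open>b\<close>: squaring doubles an exponent, the mixed product has
  \<open>a + b\<close>.\<close>

lemma sub_dom_midpoint: "sub_dom {#2 * a, 2 * b#} {#a + b, a + b#}"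
proof -
  have "\<exists>A. A \<subseteq># {#2 * a, 2 * b#} \<and> size A = size B \<and> sum_mset A \<le> sum_mset B"
    if B: "B \<subseteq># {#a + b, a + b#}" for B
  proof -
    have "set_mset B \<subseteq> {a + b}" using set_mset_mono[OF B] by auto
    then have Br: "B = replicate_mset (size B) (a + b)"
      using set_mset_subset_singletonD by fastforce
    have "size B \<le> 2" using size_mset_mono[OF B] by simp
    then consider "size B = 0" | "size B = 1" | "size B = 2" by linarith
    then show ?thesis
    proof cases
      case 1 then show ?thesis by auto
    next
      case 2
      with Br have "B = {#a + b#}" by (metis replicate_mset_0 replicate_mset_Suc One_nat_def)
      then show ?thesis by (intro exI[of _ "{#min (2 * a) (2 * b)#}"]) (auto simp: min_def)
    next
      case 3
      with Br have "B = {#a + b, a + b#}"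
        by (metis replicate_mset_0 replicate_mset_Suc numeral_2_eq_2)
      then show ?thesis by (intro exI[of _ "{#2 * a, 2 * b#}"]) auto
    qed
  qed
  then show ?thesis by (simp add: sub_dom_def)
qed

lemma T_cone_2_sub_domD:
  assumes y: "y \<in> T_cone 2 N"
    and p: "\<nu> \<in> even_partitions N" "\<nu>' \<in> even_partitions N" "\<mu> \<in> even_partitions N"
    and d: "sub_dom (\<nu> + \<nu>') (\<mu> + \<mu>)"
  shows "2 * y \<mu> \<le> y \<nu> + y \<nu>'"
proof -
  let ?f = "\<lambda>i::nat. if i = 1 then \<nu> else \<nu>'"
  have s: "{1..2} = {1, 2::nat}" by auto
  have "?f \<in> {1..2} \<rightarrow> even_partitions N" using p by auto
  moreover have "(\<Sum>i = 1..2. ?f i) \<succeq>\<^sub>s repeat_mset 2 \<mu>"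
    using sub_dom_imp_superdom[OF d] by (simp add: s numeral_2_eq_2)
  ultimately have "(\<Sum>i = 1..2. y (?f i)) \<ge> real 2 * y \<mu>"
    using y p(3) unfolding T_cone_def by blast
  then show ?thesis by (simp add: numeral_2_eq_2)
qed

text \<open>Fusing the merge comparison with itself gives an instance for \<open>k = 2\<close> with
  equal partitions on the left, so \<open>T_cone 2\<close> controls merging as well.\<close>

lemma T_cone_2_merge:
  assumes y: "y \<in> T_cone 2 N"
    and p: "add_mset a (add_mset b \<rho>) \<in> even_partitions N" "add_mset (a + b) \<rho> \<in> even_partitions N"
  shows "y (add_mset (a + b) \<rho>) \<le> y (add_mset a (add_mset b \<rho>))"
proof -
  have "sub_dom ({#a, b#} + \<rho>) ({#a + b#} + \<rho>)"
    by (intro sub_dom_add sub_dom_merge sub_dom_refl)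
  then have "sub_dom (add_mset a (add_mset b \<rho>)) (add_mset (a + b) \<rho>)" by simp
  from T_cone_2_sub_domD[OF y p(1,1,2) sub_dom_add[OF this this]] show ?thesis by simp
qed

section \<open>Sums of squares from superdominance\<close>

lemma polys_in_one [simp]: "1 \<in> polys_in n"
  by (simp add: polys_in_def)

lemma polys_in_Var [simp]: "i \<in> {1..n} \<Longrightarrow> Var i \<in> polys_in n"
  by (simp add: polys_in_def Var_def)

lemma polys_in_add: "p \<in> polys_in n \<Longrightarrow> q \<in> polys_in n \<Longrightarrow> p + q \<in> polys_in n"
  using Poly_Mapping.keys_add[of p q] by (auto simp: polys_in_def)

lemma polys_in_diff: "p \<in> polys_in n \<Longrightarrow> q \<in> polys_in n \<Longrightarrow> p - q \<in> polys_in n"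
proof -
  assume "p \<in> polys_in n" "q \<in> polys_in n"
  moreover have "Poly_Mapping.keys (p - q) \<subseteq> Poly_Mapping.keys p \<union> Poly_Mapping.keys q"
    by (auto simp: in_keys_iff lookup_minus)
  ultimately show "p - q \<in> polys_in n" unfolding polys_in_def by blast
qed

lemma polys_in_mult: 
  assumes "p \<in> polys_in n" "q \<in> polys_in n" shows "p * q \<in> polys_in n"
  unfolding polys_in_def
proof (intro CollectI ballI)
  fix e assume "e \<in> Poly_Mapping.keys (p * q)"
  then obtain a b where "a \<in> Poly_Mapping.keys p" "b \<in> Poly_Mapping.keys q" "e = a + b"
    using keys_mult by blast
  with assms have "Poly_Mapping.keys a \<union> Poly_Mapping.keys b \<subseteq> {1..n}" "e = a + b"
    by (simp_all add: polys_in_def)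
  then show "Poly_Mapping.keys e \<subseteq> {1..n}"
    using Poly_Mapping.keys_add[of a b] by blast
qed

lemma polys_in_power: "p \<in> polys_in n \<Longrightarrow> p ^ k \<in> polys_in n"
  by (induction k) (auto intro: polys_in_mult)

lemmas polys_in_closed = polys_in_add polys_in_diff polys_in_mult polys_in_power

lemma sum_of_squares_zero: "sum_of_squares n 0"
  unfolding sum_of_squares_def by (intro exI[of _ "[]"]) auto

lemma sum_of_squares_square: "q \<in> polys_in n \<Longrightarrow> sum_of_squares n (q ^ 2)"
  unfolding sum_of_squares_def by (intro exI[of _ "[q]"]) auto

lemma sum_of_squares_add:
  assumes "sum_of_squares n f" "sum_of_squares n g" shows "sum_of_squares n (f + g)"
proof -
  from assms obtain ps qs where "set ps \<subseteq> polys_in n" "f = (\<Sum>q\<leftarrow>ps. q ^ 2)"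
    "set qs \<subseteq> polys_in n" "g = (\<Sum>q\<leftarrow>qs. q ^ 2)" by (auto simp: sum_of_squares_def)
  then show ?thesis unfolding sum_of_squares_def by (intro exI[of _ "ps @ qs"]) auto
qed

lemma sum_of_squares_sum:
  "(\<And>i. i \<in> I \<Longrightarrow> sum_of_squares n (f i)) \<Longrightarrow> sum_of_squares n (sum f I)"
  by (induction I rule: infinite_finite_induct) (auto intro: sum_of_squares_zero sum_of_squares_add)

lemma sum_of_squares_mult:
  assumes "sum_of_squares n f" "sum_of_squares n g" shows "sum_of_squares n (f * g)"
proof -
  have sq: "sum_of_squares n (f * q ^ 2)" if q: "q \<in> polys_in n" for q
  proof -
    from assms(1) obtain ps where ps: "set ps \<subseteq> polys_in n" "f = (\<Sum>q\<leftarrow>ps. q ^ 2)"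
      by (auto simp: sum_of_squares_def)
    have "set (map (\<lambda>p. p * q) ps) \<subseteq> polys_in n" using ps(1) q by (auto intro: polys_in_mult)
    moreover have "f * q ^ 2 = (\<Sum>p\<leftarrow>map (\<lambda>p. p * q) ps. p ^ 2)"
      unfolding ps(2) by (induction ps) (auto simp: power_mult_distrib distrib_right)
    ultimately show ?thesis unfolding sum_of_squares_def by blast
  qed
  from assms(2) obtain qs where qs: "set qs \<subseteq> polys_in n" "g = (\<Sum>q\<leftarrow>qs. q ^ 2)"
    by (auto simp: sum_of_squares_def)
  have "sum_of_squares n (f * (\<Sum>q\<leftarrow>qs. q ^ 2))" using qs(1)
    by (induction qs) (auto simp: distrib_left intro: sum_of_squares_zero sum_of_squares_add sq)
  then show ?thesis by (simp add: qs(2))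
qed

lemma sum_of_squares_even_power:
  "p \<in> polys_in n \<Longrightarrow> even k \<Longrightarrow> sum_of_squares n (p ^ k)"
  using sum_of_squares_square[OF polys_in_power[of p n "k div 2"]]
  by (simp flip: power_mult)

text \<open>Both differences are multiples of \<open>x ^ 2 - y ^ 2\<close>. The two copies of it
  form a square, and the cofactors \<open>S e'\<close> and \<open>S f'\<close> are sums of products
  of even powers.\<close>

lemma sum_of_squares_power_diff_mult:
  assumes "x \<in> polys_in n" "y \<in> polys_in n" "even e" "even f"
  shows "sum_of_squares n ((x ^ e - y ^ e) * (x ^ f - y ^ f))"
proof -
  obtain e' f' where ef: "e = 2 * e'" "f = 2 * f'" using assms by (auto elim!: evenE)
  define S where "S k = (\<Sum>i<k. (y ^ 2) ^ (k - Suc i) * (x ^ 2) ^ i)" for k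
  have S: "sum_of_squares n (S k)" for k
    unfolding S_def using assms(1,2)
    by (intro sum_of_squares_sum sum_of_squares_mult)
       (simp_all add: sum_of_squares_even_power flip: power_mult)
  have "(x ^ e - y ^ e) * (x ^ f - y ^ f) = ((x ^ 2) ^ e' - (y ^ 2) ^ e') * ((x ^ 2) ^ f' - (y ^ 2) ^ f')"
    by (simp add: ef power_mult)
  also have "\<dots> = (x ^ 2 - y ^ 2) ^ 2 * (S e' * S f')"
    unfolding power_diff_sumr2[of "x\<^sup>2"] S_def by (simp add: power2_eq_square algebra_simps)
  finally show ?thesis
    using assms(1,2) S by (auto intro!: sum_of_squares_mult sum_of_squares_square polys_in_closed)
qed

section \<open>Merges and transfers for products of two power sums\<close>

lemma power_sum_Suc: "power_sum (Suc m) r = power_sum m r + Var (Suc m) ^ r"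
  by (simp add: power_sum_def)

lemma sum_of_squares_power_sum: "even r \<Longrightarrow> sum_of_squares n (power_sum n r)"
  unfolding power_sum_def by (intro sum_of_squares_sum sum_of_squares_even_power) auto

text \<open>The diagonal terms of the product make up \<open>power_sum n (a + b)\<close>; what
  remains are products of even powers of two distinct variables.\<close>

lemma sum_of_squares_power_sum_merge:
  assumes "even a" "even b"
  shows "sum_of_squares n (power_sum n a * power_sum n b - power_sum n (a + b))"
proof -
  have *: "(\<Sum>j=1..n. Var i ^ a * Var j ^ b) - Var i ^ (a + b)
      = (\<Sum>j\<in>{1..n} - {i}. Var i ^ a * Var j ^ b)" if "i \<in> {1..n}" for i
    using that sum.remove[of "{1..n}" i "\<lambda>j. Var i ^ a * Var j ^ b"] by (simp add: power_add)
  have "power_sum n a * power_sum n b - power_sum n (a + b)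
      = (\<Sum>i=1..n. \<Sum>j\<in>{1..n} - {i}. Var i ^ a * Var j ^ b)"
    unfolding power_sum_def sum_product sum_subtractf[symmetric] by (intro sum.cong refl *)
  also have "sum_of_squares n \<dots>"
    using assms by (intro sum_of_squares_sum sum_of_squares_mult sum_of_squares_even_power) auto
  finally show ?thesis .
qed

text \<open>The difference is the sum over pairs \<open>i < j\<close> of
  \<open>(X_i X_j)^u (X_i^e - X_j^e) (X_i^f - X_j^f)\<close>. Induction on \<open>m\<close> adds the
  pairs containing the new variable, while \<open>n\<close> stays fixed.\<close>

lemma sum_of_squares_power_sum_transfer:
  assumes "even u" "even e" "even f" "m \<le> n"
  shows "sum_of_squares n (power_sum m u * power_sum m (u + e + f)
           - power_sum m (u + e) * power_sum m (u + f))"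
  using assms(4)
proof (induction m)
  case 0
  then show ?case by (simp add: power_sum_def sum_of_squares_zero)
next
  case (Suc m)
  let ?y = "Var (Suc m)"
  let ?T = "\<lambda>i. (Var i * ?y) ^ u * ((Var i ^ e - ?y ^ e) * (Var i ^ f - ?y ^ f))"
  have "?T i = Var i ^ u * ?y ^ (u + e + f) + Var i ^ (u + e + f) * ?y ^ u
      - (Var i ^ (u + e) * ?y ^ (u + f) + Var i ^ (u + f) * ?y ^ (u + e))" for i
    by (simp add: power_add power_mult_distrib algebra_simps)
  then have "(\<Sum>i=1..m. ?T i) = power_sum m u * ?y ^ (u + e + f) + power_sum m (u + e + f) * ?y ^ u
      - (power_sum m (u + e) * ?y ^ (u + f) + power_sum m (u + f) * ?y ^ (u + e))"
    by (simp add: power_sum_def sum_distrib_right sum.distrib sum_subtractf)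
  then have "power_sum (Suc m) u * power_sum (Suc m) (u + e + f)
           - power_sum (Suc m) (u + e) * power_sum (Suc m) (u + f)
     = (power_sum m u * power_sum m (u + e + f)
           - power_sum m (u + e) * power_sum m (u + f)) + (\<Sum>i=1..m. ?T i)"
    by (simp add: power_sum_Suc algebra_simps power_add)
  moreover have "sum_of_squares n (\<Sum>i=1..m. ?T i)"
    using assms Suc.prems
    by (intro sum_of_squares_sum sum_of_squares_mult sum_of_squares_even_power
        sum_of_squares_power_diff_mult polys_in_mult polys_in_Var) auto
  ultimately show ?case using Suc by (auto intro: sum_of_squares_add)
qed

lemma sum_of_squares_power_sum_mset:
  "\<forall>r\<in>#\<mu>. even r \<Longrightarrow> sum_of_squares n (power_sum_partition n \<mu>)"
proof (induction \<mu>)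
  case empty
  show ?case using sum_of_squares_square[of 1 n] by (simp add: power_sum_partition_def)
next
  case (add x \<mu>)
  then show ?case
    by (auto simp: power_sum_partition_def intro: sum_of_squares_mult sum_of_squares_power_sum)
qed

lemma power_sum_partition_add:
  "power_sum_partition n (\<mu> + \<nu>) = power_sum_partition n \<mu> * power_sum_partition n \<nu>"
  by (simp add: power_sum_partition_def)

lemma power_sum_partition_add_mset:
  "power_sum_partition n (add_mset r \<nu>) = power_sum n r * power_sum_partition n \<nu>"
  by (simp add: power_sum_partition_def)

section \<open>From superdominance to merges and transfers\<close>

lemma sum_list_ge_bound:
  fixes b :: nat
  assumes "\<forall>y\<in>set ys. b \<le> y"
  shows "length ys * b \<le> sum_list ys"
  using assms by (induction ys) auto

lemma sum_list_le_bound: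
  fixes b :: nat
  assumes "\<forall>y\<in>set ys. y \<le> b"
  shows "sum_list ys \<le> length ys * b"
  using assms by (induction ys) auto

text \<open>
  The smallest part \<open>b\<close> of \<open>bs\<close> lies between two consecutive parts \<open>u \<le> b \<le> v\<close> of \<open>as\<close>.
  Replacing \<open>u, v\<close> by \<open>b, u + v - b\<close> keeps the position in the sorted list, so the partial sum
  conditions survive the removal of \<open>b\<close> from both sides.
\<close>

lemma sum_of_squares_dominance_same_length:
  assumes "sorted as" "sorted bs" "length as = length bs" "sum_list as = sum_list bs"
    and "\<forall>j \<le> length bs. sum_list (take j as) \<le> sum_list (take j bs)"
    and "\<forall>r \<in> set as. even r" "\<forall>r \<in> set bs. even r"
  shows "sum_of_squares n (power_sum_partition n (mset as) - power_sum_partition n (mset bs))"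
  using assms
proof (induction bs arbitrary: as)
  case Nil
  then show ?case by (simp add: sum_of_squares_zero)
next
  case (Cons b ys)
  note prems = Cons.prems
  show ?case
  proof (cases "ys = []")
    case True
    with prems have "as = [b]" by (cases as) auto
    with True show ?thesis by (simp add: sum_of_squares_zero)
  next
    case False
    obtain a0 rest where as0: "as = a0 # rest" using prems(3) by (cases as) auto
    have ysb: "\<forall>y\<in>set ys. b \<le> y" using prems(2) by simp
    have a0: "a0 \<le> b" using prems(5)[rule_format, of 1] by (simp add: as0)
    \<comment> \<open>If all parts after \<open>a0\<close> were below \<open>b\<close>, the total of
      \<open>as\<close> would fall short of that of \<open>b # ys\<close>, since
      \<open>a0 \<le> b\<close>.\<close>
    have "\<exists>v\<in>set rest. b \<le> v"
    proof (rule ccontr)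
      assume "\<not> ?thesis"
      then have "\<forall>v\<in>set rest. v \<le> b - 1" and b: "b > 0" using False prems(3) as0 by (cases rest; force)+
      then have "sum_list rest \<le> length rest * (b - 1)" by (intro sum_list_le_bound)
      also have "\<dots> < length ys * b" using prems(3) as0 b False by simp
      also have "\<dots> \<le> sum_list ys" using ysb by (rule sum_list_ge_bound)
      finally show False using prems(4) as0 a0 by simp
    qed
    then obtain ws v zs where rest: "rest = ws @ v # zs" "b \<le> v" "\<forall>w\<in>set ws. w < b"
      using split_list_first_prop[of rest "\<lambda>v. b \<le> v"] by (auto simp: not_le)
    define xs u where "xs = butlast (a0 # ws)" and "u = last (a0 # ws)"
    have xsu: "xs @ [u] = a0 # ws" unfolding xs_def u_def by (rule append_butlast_last_id) simp
    have as: "as = xs @ u # v # zs"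
      using xsu as0 rest(1) by (metis append.assoc append_Cons append_Nil)
    have xub: "\<forall>x\<in>set (xs @ [u]). x \<le> b" unfolding xsu using a0 rest(3) by auto
    then have ub: "u \<le> b" by simp
    define c where "c = u + v - b"
    have c: "u \<le> c" "c \<le> v" "u + v = b + c" using ub rest(2) by (auto simp: c_def)
    define as' where "as' = xs @ c # zs"
    have "even u" "even v" "even b" using prems(6,7) as by auto
    then have evc: "even c" using c(3) by (metis even_add)
    have IH: "sum_of_squares n (power_sum_partition n (mset as') - power_sum_partition n (mset ys))"
    proof (rule Cons.IH)
      show "sorted as'" using prems(1) c unfolding as as'_def by (auto simp: sorted_append)
      show "sorted ys" using prems(2) by simp
      show "length as' = length ys" using prems(3) unfolding as as'_def by simp
      show "sum_list as' = sum_list ys" using prems(4) c unfolding as as'_def by simp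
      show "\<forall>r\<in>set as'. even r" "\<forall>r\<in>set ys. even r"
        using prems(6,7) evc unfolding as as'_def by auto
      show "\<forall>j\<le>length ys. sum_list (take j as') \<le> sum_list (take j ys)"
      proof (intro allI impI)
        fix j assume j: "j \<le> length ys"
        show "sum_list (take j as') \<le> sum_list (take j ys)"
        \<comment> \<open>Up to this position the parts of \<open>as'\<close> are at most
          \<open>b\<close> and those of \<open>ys\<close> at least \<open>b\<close>. Beyond it,
          \<open>u + v = b + c\<close> lets \<open>b\<close> cancel in the hypothesis for
          \<open>Suc j\<close>.\<close>
        proof (cases "j \<le> length xs")
          case True
          then have "sum_list (take j as') = sum_list (take j xs)" by (simp add: as'_def)
          also have "\<dots> \<le> length (take j xs) * b"
            using xub by (intro sum_list_le_bound) (auto dest: in_set_takeD)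
          also have "\<dots> = length (take j ys) * b" using True j by simp
          also have "\<dots> \<le> sum_list (take j ys)"
            using ysb by (intro sum_list_ge_bound) (auto dest: in_set_takeD)
          finally show ?thesis .
        next
          case False
          then obtain k where k: "j = length xs + Suc k" by (metis less_imp_Suc_add not_le add_Suc_right)
          have "sum_list (take (Suc j) as) \<le> sum_list (take (Suc j) (b # ys))"
            using prems(5) j by auto
          then show ?thesis using c unfolding as as'_def k by (simp add: take_append)
        qed
      qed
    qed
    have "v = u + (b - u) + (c - u)" "b = u + (b - u)" "c = u + (c - u)" using c ub by auto
    then have tr: "sum_of_squares n (power_sum n u * power_sum n v - power_sum n b * power_sum n c)"
      using sum_of_squares_power_sum_transfer[of u "b - u" "c - u" n n] \<open>even u\<close> \<open>even b\<close> evc by simp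
    have "power_sum_partition n (mset as) - power_sum_partition n (mset (b # ys))
      = (power_sum n u * power_sum n v - power_sum n b * power_sum n c) * power_sum_partition n (mset (xs @ zs))
        + power_sum n b * (power_sum_partition n (mset as') - power_sum_partition n (mset ys))"
      unfolding as as'_def by (simp add: power_sum_partition_add power_sum_partition_add_mset algebra_simps)
    also have "sum_of_squares n \<dots>"
      using prems(6) \<open>even b\<close> as
      by (intro sum_of_squares_add sum_of_squares_mult tr IH sum_of_squares_power_sum
          sum_of_squares_power_sum_mset) auto
    finally show ?thesis .
  qed
qed

text \<open>Merging the two largest parts of \<open>as\<close> changes no earlier partial sum and
  shortens the list by one, until the lengths agree.\<close>

lemma sum_of_squares_dominance:
  assumes "sorted as" "sorted bs" "sum_list as = sum_list bs" "0 \<notin> set as" "0 \<notin> set bs"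
    and "\<forall>j \<le> min (length as) (length bs). sum_list (take j as) \<le> sum_list (take j bs)"
    and "\<forall>r \<in> set as. even r" "\<forall>r \<in> set bs. even r"
  shows "sum_of_squares n (power_sum_partition n (mset as) - power_sum_partition n (mset bs))"
  using assms
proof (induction "length as - length bs" arbitrary: as)
  case 0
  \<comment> \<open>If \<open>as\<close> were shorter, the condition at \<open>j = length as\<close>
    would make the remaining parts of \<open>bs\<close> sum to zero, although they are
    positive.\<close>
  have "length bs \<le> length as"
  proof (rule ccontr)
    assume "\<not> length bs \<le> length as"
    then have "sum_list as \<le> sum_list (take (length as) bs)" "drop (length as) bs \<noteq> []"
      using 0(7)[rule_format, of "length as"] by auto
    moreover have "sum_list bs = sum_list (take (length as) bs) + sum_list (drop (length as) bs)"
      by (simp flip: sum_list_append)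
    ultimately have "sum_list (drop (length as) bs) = 0" using 0(4) by linarith
    moreover have "hd (drop (length as) bs) \<in> set (drop (length as) bs)"
      using \<open>drop (length as) bs \<noteq> []\<close> by (rule hd_in_set)
    ultimately have "0 \<in> set (drop (length as) bs)" by (auto simp: sum_list_eq_0_iff)
    then show False using 0(6) by (meson in_set_dropD)
  qed
  with 0(1) have "length as = length bs" by simp
  then show ?case
    using 0(7) by (intro sum_of_squares_dominance_same_length 0) simp_all
next
  case (Suc k)
  note prems = Suc.prems
  have "bs \<noteq> []"
  proof
    assume "bs = []"
    then have "sum_list as = 0" "as \<noteq> []" using prems(3) Suc.hyps(2) by auto
    then have "hd as = 0" using hd_in_set[of as] by (auto simp: sum_list_eq_0_iff)
    then show False using prems(4) hd_in_set[OF \<open>as \<noteq> []\<close>] by simp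
  qed
  then have "length bs \<ge> 1" by (cases bs) auto
  with Suc.hyps(2) have len: "length as \<ge> 2" using Suc.hyps(2) by auto
  obtain as1 v where as1: "as = as1 @ [v]" using len by (cases as rule: rev_cases) auto
  obtain xs u where "as1 = xs @ [u]" using len as1 by (cases as1 rule: rev_cases) auto
  with as1 have as: "as = xs @ [u, v]" by simp
  define as' where "as' = xs @ [u + v]"
  have ev: "even u" "even v" using prems(7) as by auto
  have IH: "sum_of_squares n (power_sum_partition n (mset as') - power_sum_partition n (mset bs))"
  proof (rule Suc.hyps(1))
    show "k = length as' - length bs" using Suc.hyps(2) unfolding as as'_def by simp
    show "sorted as'" using prems(1) unfolding as as'_def by (auto simp: sorted_append)
    show "sum_list as' = sum_list bs" using prems(3) unfolding as as'_def by simp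
    show "0 \<notin> set as'" using prems(4) unfolding as as'_def by auto
    show "\<forall>r\<in>set as'. even r" using prems(7) ev unfolding as as'_def by auto
    show "\<forall>j\<le>min (length as') (length bs). sum_list (take j as') \<le> sum_list (take j bs)"
    proof (intro allI impI)
      fix j assume j: "j \<le> min (length as') (length bs)"
      show "sum_list (take j as') \<le> sum_list (take j bs)"
      proof (cases "j \<le> length xs")
        case True
        then show ?thesis using prems(6)[rule_format, of j] j by (simp add: as as'_def)
      next
        case False
        \<comment> \<open>Since \<open>bs\<close> is no longer than \<open>as'\<close>, only the
          full sums are left here, and these are equal.\<close>
        then have "j = length as'" "j = length bs"
          using j Suc.hyps(2) by (auto simp: as as'_def)
        then show ?thesis using \<open>sum_list as' = sum_list bs\<close> by simp
      qed
    qed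
  qed (fact prems)+
  have "power_sum_partition n (mset as) - power_sum_partition n (mset bs)
    = (power_sum n u * power_sum n v - power_sum n (u + v)) * power_sum_partition n (mset xs)
      + (power_sum_partition n (mset as') - power_sum_partition n (mset bs))"
    unfolding as as'_def by (simp add: power_sum_partition_add power_sum_partition_add_mset algebra_simps)
  also have "sum_of_squares n \<dots>"
    using prems(7) ev as
    by (intro sum_of_squares_add sum_of_squares_mult IH sum_of_squares_power_sum_merge
        sum_of_squares_power_sum_mset) auto
  finally show ?case .
qed

lemma sum_of_squares_superdom:
  assumes "\<nu> \<in> even_partitions N" "\<mu> \<in> even_partitions N" "\<nu> \<succeq>\<^sub>s \<mu>"
  shows "sum_of_squares n (power_sum_partition n \<nu> - power_sum_partition n \<mu>)"
proof -
  let ?as = "sorted_list_of_multiset \<nu>" and ?bs = "sorted_list_of_multiset \<mu>"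
  have len: "length ?as = size \<nu>" "length ?bs = size \<mu>"
    by (metis mset_sorted_list_of_multiset size_mset)+
  have sums: "sum_list ?as = sum_mset \<nu>" "sum_list ?bs = sum_mset \<mu>"
    using sum_mset_sum_list[of ?as] sum_mset_sum_list[of ?bs] by simp_all
  have "sum_of_squares n (power_sum_partition n (mset ?as) - power_sum_partition n (mset ?bs))"
  proof (rule sum_of_squares_dominance)
    show "\<forall>j\<le>min (length ?as) (length ?bs). sum_list (take j ?as) \<le> sum_list (take j ?bs)"
    proof (intro allI impI)
      fix j assume j: "j \<le> min (length ?as) (length ?bs)"
      show "sum_list (take j ?as) \<le> sum_list (take j ?bs)"
        using assms(3) j unfolding superdom_def len by (cases "j = 0") auto
    qed
  qed (use assms in \<open>auto simp: sums even_partitions_def partitions_def\<close>)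
  then show ?thesis by simp
qed

section \<open>The first inclusion\<close>

lemma Const_simps: "Const 0 = 0" "Const 1 = 1" "Const (-1) = -1"
  by (simp_all add: Const_def single_uminus)

lemma dual_cone_B_Sigma_superdom:
  assumes p: "\<nu> \<in> even_partitions N" "\<mu> \<in> even_partitions N" "\<nu> \<succeq>\<^sub>s \<mu>"
    and \<phi>: "\<phi> \<in> dual_cone (even_partitions N) (B_Sigma N)"
  shows "\<phi> \<mu> \<le> \<phi> \<nu>"
proof (cases "\<nu> = \<mu>")
  case False
  let ?I = "even_partitions N"
  \<comment> \<open>Coefficient vector of the form \<open>p_\<nu> - p_\<mu>\<close>, used as a test
    element of the cone.\<close>
  define c :: "nat multiset \<Rightarrow> real" where
    "c = (\<lambda>\<kappa>\<in>?I. (if \<kappa> = \<nu> then 1 else 0) + (if \<kappa> = \<mu> then -1 else 0))"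
  have fin: "finite ?I" by (rule finite_even_partitions)
  have "(\<Sum>\<kappa>\<in>?I. Const (c \<kappa>) * power_sum_partition n \<kappa>)
      = (\<Sum>\<kappa>\<in>?I. (if \<kappa> = \<nu> then power_sum_partition n \<kappa> else 0)
           - (if \<kappa> = \<mu> then power_sum_partition n \<kappa> else 0))" for n
    using False by (intro sum.cong) (auto simp: c_def Const_simps)
  then have "(\<Sum>\<kappa>\<in>?I. Const (c \<kappa>) * power_sum_partition n \<kappa>)
      = power_sum_partition n \<nu> - power_sum_partition n \<mu>" for n
    using fin p by (simp add: sum_subtractf)
  then have "c \<in> B_Sigma N"
    using sum_of_squares_superdom[OF p] by (simp add: B_Sigma_def c_def)
  then have "0 \<le> (\<Sum>\<kappa>\<in>?I. c \<kappa> * \<phi> \<kappa>)" using \<phi> by (auto simp: dual_cone_def)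
  also have "\<dots> = (\<Sum>\<kappa>\<in>?I. (if \<kappa> = \<nu> then \<phi> \<kappa> else 0) - (if \<kappa> = \<mu> then \<phi> \<kappa> else 0))"
    using False by (intro sum.cong) (auto simp: c_def)
  also have "\<dots> = \<phi> \<nu> - \<phi> \<mu>" using fin p by (simp add: sum_subtractf)
  finally show ?thesis by simp
qed simp

text \<open>Logarithms to a base above 1 and limits preserve the inequalities between coordinates
  that hold on the dual cone; for \<open>k = 1\<close> these are exactly the defining
  conditions.\<close>

lemma trop_subset_T_cone_1:
  "trop (even_partitions N) (dual_cone (even_partitions N) (B_Sigma N)) \<subseteq> T_cone 1 N"
proof
  fix y assume "y \<in> trop (even_partitions N) (dual_cone (even_partitions N) (B_Sigma N))"
  then obtain x \<tau> where y: "y \<in> even_partitions N \<rightarrow>\<^sub>E UNIV"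
    and x: "\<And>m. x m \<in> dual_cone (even_partitions N) (B_Sigma N)" "\<And>m i. i \<in> even_partitions N \<Longrightarrow> x m i > 0"
    and \<tau>: "\<And>m::nat. 0 < \<tau> m" "\<And>m. \<tau> m < 1"
    and lim: "\<And>i. i \<in> even_partitions N \<Longrightarrow> (\<lambda>m. log (1 / \<tau> m) (x m i)) \<longlonglongrightarrow> y i"
    unfolding trop_def by blast
  have "y \<mu> \<le> y \<nu>" if p: "\<nu> \<in> even_partitions N" "\<mu> \<in> even_partitions N" "\<nu> \<succeq>\<^sub>s \<mu>" for \<nu> \<mu>
  proof (rule LIMSEQ_le[OF lim[OF p(2)] lim[OF p(1)]], intro exI allI impI)
    fix m :: nat
    have "1 / \<tau> m > 1" using \<tau>[of m] by simp
    then show "log (1 / \<tau> m) (x m \<mu>) \<le> log (1 / \<tau> m) (x m \<nu>)"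
      using dual_cone_B_Sigma_superdom[OF p x(1)] x(2)[OF p(1)] x(2)[OF p(2)] by simp
  qed
  then show "y \<in> T_cone 1 N" using y by (auto simp: T_cone_def repeat_mset_Suc Pi_def)
qed

section \<open>Linear functionals on polynomials\<close>

text \<open>The linear functional on polynomials with prescribed values \<open>h e\<close> on the
  monomials.\<close>

definition functional :: "((nat \<Rightarrow>\<^sub>0 nat) \<Rightarrow> real) \<Rightarrow> rpoly \<Rightarrow> real" where
  "functional h f = (\<Sum>e\<in>Poly_Mapping.keys f. Poly_Mapping.lookup f e * h e)"

lemma functional_superset:
  assumes "finite S" "Poly_Mapping.keys f \<subseteq> S"
  shows "functional h f = (\<Sum>e\<in>S. Poly_Mapping.lookup f e * h e)"
  unfolding functional_def using assms
  by (intro sum.mono_neutral_left) (auto simp: in_keys_iff)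

lemma functional_zero [simp]: "functional h 0 = 0"
  by (simp add: functional_def)

lemma functional_add: "functional h (f + g) = functional h f + functional h g"
proof -
  let ?S = "Poly_Mapping.keys f \<union> Poly_Mapping.keys g"
  have "functional h (f + g) = (\<Sum>e\<in>?S. Poly_Mapping.lookup (f + g) e * h e)"
    by (rule functional_superset) (use Poly_Mapping.keys_add[of f g] in auto)
  also have "\<dots> = (\<Sum>e\<in>?S. Poly_Mapping.lookup f e * h e) + (\<Sum>e\<in>?S. Poly_Mapping.lookup g e * h e)"
    by (simp add: lookup_add distrib_right sum.distrib)
  also have "\<dots> = functional h f + functional h g"
    by (simp flip: functional_superset)
  finally show ?thesis .
qed

lemma functional_sum: "functional h (sum f I) = (\<Sum>i\<in>I. functional h (f i))"
  by (induction I rule: infinite_finite_induct) (simp_all add: functional_add)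

lemma functional_sum_list: "functional h (\<Sum>q\<leftarrow>qs. f q) = (\<Sum>q\<leftarrow>qs. functional h (f q))"
  by (induction qs) (simp_all add: functional_add)

lemma functional_single: "functional h (Poly_Mapping.single e c) = c * h e"
  by (simp add: functional_def)

lemma poly_mapping_sum_single: "(\<Sum>a\<in>Poly_Mapping.keys p. Poly_Mapping.single a (Poly_Mapping.lookup p a)) = p"
  by (rule poly_mapping_eqI)
     (auto simp: lookup_sum lookup_single when_def sum.delta' in_keys_iff)

lemma functional_mult:
  "functional h (p * q) = (\<Sum>a\<in>Poly_Mapping.keys p. \<Sum>b\<in>Poly_Mapping.keys q. Poly_Mapping.lookup p a * Poly_Mapping.lookup q b * h (a + b))"
proof -
  have "p * q = (\<Sum>a\<in>Poly_Mapping.keys p. Poly_Mapping.single a (Poly_Mapping.lookup p a)) *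
      (\<Sum>b\<in>Poly_Mapping.keys q. Poly_Mapping.single b (Poly_Mapping.lookup q b))"
    by (simp only: poly_mapping_sum_single)
  then show ?thesis
    by (simp add: sum_product mult_single functional_sum functional_single)
qed

lemma functional_Const_mult: "functional h (Const c * q) = c * functional h q"
  by (cases "c = 0") (simp_all add: functional_mult Const_def,
      simp add: functional_def sum_distrib_left mult.assoc)

section \<open>Shapes of monomials\<close>

definition shape :: "(nat \<Rightarrow>\<^sub>0 nat) \<Rightarrow> nat multiset" where
  "shape e = image_mset (Poly_Mapping.lookup e) (mset_set (Poly_Mapping.keys e))"

lemma size_shape: "size (shape e) = card (Poly_Mapping.keys e)"
  by (simp add: shape_def)

lemma shape_zero [simp]: "shape 0 = {#}"
  by (simp add: shape_def)

lemma zero_notin_shape: "0 \<notin># shape e"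
  by (auto simp: shape_def in_keys_iff)

lemma sum_mset_shape: "sum_mset (shape e) = (\<Sum>i\<in>Poly_Mapping.keys e. Poly_Mapping.lookup e i)"
  by (simp add: shape_def sum_unfold_sum_mset)

lemma sum_mset_shape_add: "sum_mset (shape (a + b)) = sum_mset (shape a) + sum_mset (shape b)"
  unfolding sum_mset_shape by (rule setsum_keys_plus_distrib) auto

lemma keys_add_nat:
  fixes a b :: "nat \<Rightarrow>\<^sub>0 nat"
  shows "Poly_Mapping.keys (a + b) = Poly_Mapping.keys a \<union> Poly_Mapping.keys b"
  by (auto simp: in_keys_iff lookup_add)

lemma shape_add_single_new:
  assumes "i \<notin> Poly_Mapping.keys e" "r \<noteq> 0"
  shows "shape (e + Poly_Mapping.single i r) = add_mset r (shape e)"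
proof -
  have "Poly_Mapping.lookup e i = 0" using assms by (simp add: in_keys_iff)
  moreover have "image_mset (Poly_Mapping.lookup (e + Poly_Mapping.single i r)) (mset_set (Poly_Mapping.keys e))
      = image_mset (Poly_Mapping.lookup e) (mset_set (Poly_Mapping.keys e))"
    using assms by (intro image_mset_cong) (auto simp: lookup_add lookup_single when_def)
  ultimately show ?thesis
    using assms by (simp add: shape_def keys_add_nat lookup_add)
qed

lemma shape_add_single_old:
  assumes "i \<in> Poly_Mapping.keys e"
  obtains \<rho> where "shape e = add_mset (Poly_Mapping.lookup e i) \<rho>"
    "shape (e + Poly_Mapping.single i r) = add_mset (Poly_Mapping.lookup e i + r) \<rho>"
proof
  let ?\<rho> = "image_mset (Poly_Mapping.lookup e) (mset_set (Poly_Mapping.keys e - {i}))"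
  have K: "mset_set (Poly_Mapping.keys e) = add_mset i (mset_set (Poly_Mapping.keys e - {i}))"
    using assms by (simp add: mset_set.remove)
  have "Poly_Mapping.keys (e + Poly_Mapping.single i r) = Poly_Mapping.keys e"
    using assms by (auto simp: keys_add_nat)
  moreover have "image_mset (Poly_Mapping.lookup (e + Poly_Mapping.single i r)) (mset_set (Poly_Mapping.keys e - {i})) = ?\<rho>"
    by (intro image_mset_cong) (auto simp: lookup_add lookup_single when_def)
  ultimately show "shape (e + Poly_Mapping.single i r) = add_mset (Poly_Mapping.lookup e i + r) ?\<rho>"
    unfolding shape_def by (simp add: K lookup_add)
  show "shape e = add_mset (Poly_Mapping.lookup e i) ?\<rho>"
    unfolding shape_def by (simp add: K)
qed

lemma Var_power: "Var i ^ r = Poly_Mapping.single (Poly_Mapping.single i r) 1"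
proof (induction r)
  case 0
  then show ?case by simp
next
  case (Suc r)
  then show ?case by (simp add: Var_def mult_single flip: single_add)
qed

lemma single_mult_power_sum:
  "Poly_Mapping.single e 1 * power_sum n r
     = (\<Sum>i=1..n. Poly_Mapping.single (e + Poly_Mapping.single i r) 1)"
  by (simp add: power_sum_def Var_power sum_distrib_left mult_single)

lemma functional_power_sum_partition_add_mset:
  "functional h (Poly_Mapping.single e 1 * power_sum_partition n (add_mset r \<mu>))
     = (\<Sum>i=1..n. functional h (Poly_Mapping.single (e + Poly_Mapping.single i r) 1
          * power_sum_partition n \<mu>))"
  unfolding power_sum_partition_add_mset mult.assoc[symmetric] single_mult_power_sum
  by (simp add: sum_distrib_right functional_sum)

lemma size_le_sum_mset: "0 \<notin># \<mu> \<Longrightarrow> size \<mu> \<le> sum_mset (\<mu> :: nat multiset)"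
  by (induction \<mu>) auto

text \<open>
  Multiplication by a power sum hits at least \<open>n / 2\<close> new variables, each at the cost of a factor
  \<open>1 / n\<close>, and at most \<open>N\<close> old ones, which merge two parts of the shape.
\<close>

lemma functional_power_sum_partition_bounds:
  assumes Y: "\<And>\<mu>. Y \<mu> > (0::real)"
    and merge: "\<And>a b \<rho>. add_mset a (add_mset b \<rho>) \<in> even_partitions N \<Longrightarrow>
        add_mset (a + b) \<rho> \<in> even_partitions N \<Longrightarrow>
        Y (add_mset (a + b) \<rho>) \<le> Y (add_mset a (add_mset b \<rho>))"
    and n: "n \<ge> 2 * N" "n \<ge> 1" and cC: "0 < c" "0 < C"
    and h: "\<And>e. Poly_Mapping.keys e \<subseteq> {1..n} \<Longrightarrow> shape e \<in> even_partitions N \<Longrightarrow>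
        c * Y (shape e) / real n ^ card (Poly_Mapping.keys e) \<le> h e \<and> h e \<le> C * Y (shape e) / real n ^ card (Poly_Mapping.keys e)"
    and e: "Poly_Mapping.keys e \<subseteq> {1..n}" "shape e + \<mu> \<in> even_partitions N"
  shows "c * (1 / 2) ^ size \<mu> * Y (shape e + \<mu>) / real n ^ card (Poly_Mapping.keys e)
           \<le> functional h (Poly_Mapping.single e 1 * power_sum_partition n \<mu>)
       \<and> functional h (Poly_Mapping.single e 1 * power_sum_partition n \<mu>)
           \<le> C * real (N + 1) ^ size \<mu> * Y (shape e + \<mu>) / real n ^ card (Poly_Mapping.keys e)"
  using e
proof (induction \<mu> arbitrary: e)
  case empty
  then show ?case using h[of e] by (simp add: power_sum_partition_def functional_single)
next
  case (add r \<mu>)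
  let ?G = "\<lambda>i. functional h (Poly_Mapping.single (e + Poly_Mapping.single i r) 1 * power_sum_partition n \<mu>)"
  let ?k = "card (Poly_Mapping.keys e)" and ?Z = "Y (shape e + add_mset r \<mu>)"
  let ?L = "c * (1 / 2) ^ size \<mu>" and ?U = "C * real (N + 1) ^ size \<mu>"
  have EP: "shape e + add_mset r \<mu> \<in> even_partitions N" by fact
  then have r: "r \<noteq> 0" "even r" by (auto simp: even_partitions_def partitions_def)
  have pos: "?L > 0" "?U > 0" "?Z > 0" "real n > 0" using cC Y n by auto
  have "size (shape e) \<le> sum_mset (shape e)" by (rule size_le_sum_mset) (rule zero_notin_shape)
  also have "\<dots> \<le> N" using EP by (auto simp: even_partitions_def partitions_def)
  finally have k: "?k \<le> N" by (simp add: size_shape)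
  have new: "?L * ?Z / real n ^ Suc ?k \<le> ?G i \<and> ?G i \<le> ?U * ?Z / real n ^ Suc ?k"
    if i: "i \<in> {1..n} - Poly_Mapping.keys e" for i
  proof -
    have "Poly_Mapping.keys (e + Poly_Mapping.single i r) = insert i (Poly_Mapping.keys e)"
      using i r by (auto simp: keys_add_nat)
    moreover have "shape (e + Poly_Mapping.single i r) + \<mu> = shape e + add_mset r \<mu>"
      using i r by (simp add: shape_add_single_new)
    ultimately show ?thesis
      using add.IH[of "e + Poly_Mapping.single i r"] i add.prems by simp
  qed
  have old: "0 \<le> ?G i \<and> ?G i \<le> ?U * ?Z / real n ^ ?k" if i: "i \<in> Poly_Mapping.keys e" for i
  proof -
    obtain \<rho> where \<rho>: "shape e = add_mset (Poly_Mapping.lookup e i) \<rho>"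
      "shape (e + Poly_Mapping.single i r) = add_mset (Poly_Mapping.lookup e i + r) \<rho>"
      using shape_add_single_old[OF i] by blast
    have K: "Poly_Mapping.keys (e + Poly_Mapping.single i r) = Poly_Mapping.keys e"
      using i by (auto simp: keys_add_nat)
    have EP': "add_mset (Poly_Mapping.lookup e i) (add_mset r (\<rho> + \<mu>)) \<in> even_partitions N"
      using EP by (simp add: \<rho>(1) add_mset_commute)
    moreover from this have EP2: "add_mset (Poly_Mapping.lookup e i + r) (\<rho> + \<mu>) \<in> even_partitions N"
      by (auto simp: even_partitions_def partitions_def)
    ultimately have "Y (add_mset (Poly_Mapping.lookup e i + r) (\<rho> + \<mu>)) \<le> Y (add_mset (Poly_Mapping.lookup e i) (add_mset r (\<rho> + \<mu>)))"
      by (rule merge)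
    then have Z: "Y (shape (e + Poly_Mapping.single i r) + \<mu>) \<le> ?Z"
      by (simp add: \<rho> add_mset_commute)
    have IH: "?L * Y (shape (e + Poly_Mapping.single i r) + \<mu>) / real n ^ ?k \<le> ?G i"
      "?G i \<le> ?U * Y (shape (e + Poly_Mapping.single i r) + \<mu>) / real n ^ ?k"
      using add.IH[of "e + Poly_Mapping.single i r"] EP2 add.prems by (simp_all add: K \<rho>(2))
    have "0 \<le> ?L * Y (shape (e + Poly_Mapping.single i r) + \<mu>) / real n ^ ?k"
      using pos Y[of "shape (e + Poly_Mapping.single i r) + \<mu>"] by simp
    moreover have "?U * Y (shape (e + Poly_Mapping.single i r) + \<mu>) / real n ^ ?k \<le> ?U * ?Z / real n ^ ?k"
      using pos Z by (intro divide_right_mono mult_left_mono) auto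
    ultimately show ?thesis using IH by linarith
  qed
  have split: "(\<Sum>i=1..n. ?G i) = (\<Sum>i\<in>{1..n} - Poly_Mapping.keys e. ?G i) + (\<Sum>i\<in>Poly_Mapping.keys e. ?G i)"
    using add.prems(1) by (rule sum.subset_diff) simp
  have card: "real (card ({1..n} - Poly_Mapping.keys e)) = real n - real ?k" "?k \<le> n"
    using add.prems(1) card_mono[OF _ add.prems(1)] by (simp_all add: card_Diff_subset of_nat_diff)
  have "?L * (1 / 2) * ?Z / real n ^ ?k = (real n / 2) * (?L * ?Z / real n ^ Suc ?k)"
    using pos by (simp add: field_simps)
  also have "\<dots> \<le> real (card ({1..n} - Poly_Mapping.keys e)) * (?L * ?Z / real n ^ Suc ?k)"
    using pos k n card by (intro mult_right_mono) auto
  also have "\<dots> \<le> (\<Sum>i\<in>{1..n} - Poly_Mapping.keys e. ?G i)"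
    using new by (intro sum_bounded_below) blast
  also have "\<dots> \<le> (\<Sum>i=1..n. ?G i)"
    unfolding split using old by (simp add: sum_nonneg)
  finally have lower: "?L * (1 / 2) * ?Z / real n ^ ?k \<le> (\<Sum>i=1..n. ?G i)" .
  have "(\<Sum>i\<in>{1..n} - Poly_Mapping.keys e. ?G i) \<le> real (card ({1..n} - Poly_Mapping.keys e)) * (?U * ?Z / real n ^ Suc ?k)"
    using new by (intro sum_bounded_above) blast
  also have "\<dots> \<le> real n * (?U * ?Z / real n ^ Suc ?k)"
    using pos card by (intro mult_right_mono) auto
  also have "\<dots> = ?U * ?Z / real n ^ ?k" using pos by simp
  finally have 1: "(\<Sum>i\<in>{1..n} - Poly_Mapping.keys e. ?G i) \<le> ?U * ?Z / real n ^ ?k" .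
  have "(\<Sum>i\<in>Poly_Mapping.keys e. ?G i) \<le> real ?k * (?U * ?Z / real n ^ ?k)"
    using old by (intro sum_bounded_above) blast
  also have "\<dots> \<le> real N * (?U * ?Z / real n ^ ?k)"
    using pos k by (intro mult_right_mono) auto
  finally have 2: "(\<Sum>i\<in>Poly_Mapping.keys e. ?G i) \<le> real N * (?U * ?Z / real n ^ ?k)" .
  have succ: "real (N + 1) * B = B + real N * B" for B by (simp add: distrib_right)
  have "(\<Sum>i=1..n. ?G i) \<le> real (N + 1) * (?U * ?Z / real n ^ ?k)"
    unfolding split succ by (rule add_mono[OF 1 2])
  with lower show ?case
    unfolding functional_power_sum_partition_add_mset by (simp add: mult_ac)
qed

section \<open>Homogeneity of the polynomials in a homogeneous sum of squares\<close>

definition homogeneous :: "nat \<Rightarrow> rpoly \<Rightarrow> bool" where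
  "homogeneous D p \<longleftrightarrow> (\<forall>e\<in>Poly_Mapping.keys p. sum_mset (shape e) = D)"

lemma homogeneous_sum: "(\<And>i. i \<in> I \<Longrightarrow> homogeneous D (f i)) \<Longrightarrow> homogeneous D (sum f I)"
proof (induction I rule: infinite_finite_induct)
  case (insert i I)
  then show ?case
    using Poly_Mapping.keys_add[of "f i" "sum f I"] by (auto simp: homogeneous_def)
qed (auto simp: homogeneous_def)

lemma homogeneous_mult:
  assumes "homogeneous D p" "homogeneous E q" shows "homogeneous (D + E) (p * q)"
  unfolding homogeneous_def
proof
  fix e assume "e \<in> Poly_Mapping.keys (p * q)"
  then obtain a b where "a \<in> Poly_Mapping.keys p" "b \<in> Poly_Mapping.keys q" "e = a + b"
    using keys_mult by blast
  with assms show "sum_mset (shape e) = D + E"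
    by (simp add: homogeneous_def sum_mset_shape_add)
qed

lemma homogeneous_Const: "homogeneous 0 (Const c)"
  by (simp add: homogeneous_def Const_def)

lemma homogeneous_power_sum: "homogeneous r (power_sum n r)"
  unfolding power_sum_def
  by (intro homogeneous_sum) (simp add: homogeneous_def Var_power sum_mset_shape)

lemma homogeneous_power_sum_partition: "homogeneous (sum_mset \<mu>) (power_sum_partition n \<mu>)"
proof (induction \<mu>)
  case empty
  then show ?case by (simp add: power_sum_partition_def homogeneous_def)
next
  case (add r \<mu>)
  then show ?case
    by (simp add: power_sum_partition_add_mset homogeneous_mult homogeneous_power_sum)
qed

text \<open>By \<open>ext\<close> only the pair \<open>(m, m)\<close> produces the exponent
  \<open>m + m\<close>, so its coefficient is the sum of the squared coefficients of
  \<open>m\<close>, which is positive.\<close>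

lemma double_extremal_in_keys_sum_of_squares:
  fixes qs :: "rpoly list"
  assumes m: "q \<in> set qs" "m \<in> Poly_Mapping.keys q"
    and ext: "\<And>q a b. q \<in> set qs \<Longrightarrow> a \<in> Poly_Mapping.keys q \<Longrightarrow> b \<in> Poly_Mapping.keys q \<Longrightarrow> a + b = m + m \<Longrightarrow> a = m \<and> b = m"
  shows "m + m \<in> Poly_Mapping.keys (\<Sum>q\<leftarrow>qs. q ^ 2)"
proof -
  define h :: "(nat \<Rightarrow>\<^sub>0 nat) \<Rightarrow> real" where "h e = (if e = m + m then 1 else 0)" for e
  have coeff: "functional h p = Poly_Mapping.lookup p (m + m)" for p
    unfolding functional_def h_def by (auto simp: in_keys_iff sum.delta' if_distrib cong: if_cong)
  have sq: "functional h (q ^ 2) = (Poly_Mapping.lookup q m)\<^sup>2" if q: "q \<in> set qs" for q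
  proof -
    have "functional h (q ^ 2) = (\<Sum>a\<in>Poly_Mapping.keys q. \<Sum>b\<in>Poly_Mapping.keys q. Poly_Mapping.lookup q a * Poly_Mapping.lookup q b * h (a + b))"
      by (simp add: power2_eq_square functional_mult)
    also have "\<dots> = (\<Sum>a\<in>Poly_Mapping.keys q. \<Sum>b\<in>Poly_Mapping.keys q.
        (if a = m then Poly_Mapping.lookup q a else 0) * (if b = m then Poly_Mapping.lookup q b else 0))"
    proof (intro sum.cong refl)
      fix a b assume ab: "a \<in> Poly_Mapping.keys q" "b \<in> Poly_Mapping.keys q"
      have "h (a + b) = (if a = m then 1 else 0) * (if b = m then 1 else 0)"
      proof (cases "a + b = m + m")
        case True
        then show ?thesis using ext[OF q ab True] by (simp add: h_def)
      next
        case False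
        then have "\<not> (a = m \<and> b = m)" by blast
        with False show ?thesis by (auto simp: h_def)
      qed
      then show "Poly_Mapping.lookup q a * Poly_Mapping.lookup q b * h (a + b)
          = (if a = m then Poly_Mapping.lookup q a else 0) * (if b = m then Poly_Mapping.lookup q b else 0)"
        by simp
    qed
    also have "\<dots> = (\<Sum>a\<in>Poly_Mapping.keys q. if a = m then Poly_Mapping.lookup q a else 0)
        * (\<Sum>b\<in>Poly_Mapping.keys q. if b = m then Poly_Mapping.lookup q b else 0)"
      by (simp only: sum_product)
    also have "(\<Sum>a\<in>Poly_Mapping.keys q. if a = m then Poly_Mapping.lookup q a else 0) = Poly_Mapping.lookup q m"
      by (simp add: in_keys_iff)
    finally show ?thesis by (simp add: power2_eq_square)
  qed
  have "Poly_Mapping.lookup (\<Sum>q\<leftarrow>qs. q ^ 2) (m + m) = (\<Sum>q\<leftarrow>qs. functional h (q ^ 2))"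
    by (simp add: functional_sum_list flip: coeff)
  also have "\<dots> = (\<Sum>q\<leftarrow>qs. (Poly_Mapping.lookup q m)\<^sup>2)"
    using sq by (intro arg_cong[of _ _ sum_list] map_cong) auto
  also have "\<dots> > 0"
  proof -
    have "0 < (Poly_Mapping.lookup q m)\<^sup>2" using m by (simp add: in_keys_iff)
    also have "\<dots> \<le> (\<Sum>q\<leftarrow>qs. (Poly_Mapping.lookup q m)\<^sup>2)"
      using m(1) by (intro member_le_sum_list) auto
    finally show ?thesis .
  qed
  finally show ?thesis by (simp add: in_keys_iff)
qed

text \<open>
  In the top (or bottom) degree layer of the exponents of the \<open>q\<^sub>i\<close>, the largest exponent \<open>m\<close> in a
  monomial order gives the exponent \<open>2m\<close> of \<open>\<Sum> q\<^sub>i\<^sup>2\<close>, as squares cannot cancel there.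
\<close>

lemma homogeneous_sum_of_squares:
  assumes hom: "homogeneous (2 * D) (\<Sum>q\<leftarrow>qs. q ^ 2)" and "q \<in> set qs"
  shows "homogeneous D q"
proof -
  define deg where "deg e = sum_mset (shape e)" for e
  define S where "S = (\<Union>q\<in>set qs. Poly_Mapping.keys q)"
  have fin: "finite S" by (simp add: S_def)
  have deg_add: "deg (a + b) = deg a + deg b" for a b by (simp add: deg_def sum_mset_shape_add)
  have layer: "k = D" if k: "k \<in> deg ` S"
    and ext: "\<And>i j. i \<in> deg ` S \<Longrightarrow> j \<in> deg ` S \<Longrightarrow> i + j = 2 * k \<Longrightarrow> i = k \<and> j = k" for k
  proof -
    define T where "T = {e \<in> S. deg e = k}"
    have T: "finite T" "T \<noteq> {}" using fin k by (auto simp: T_def)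
    define m where "m = Max T"
    have mT: "m \<in> T" unfolding m_def using T by (rule Max_in)
    have le: "a \<le> m" if "a \<in> T" for a unfolding m_def using T(1) that by (rule Max_ge)
    obtain p where p: "p \<in> set qs" "m \<in> Poly_Mapping.keys p" using mT by (auto simp: T_def S_def)
    have "m + m \<in> Poly_Mapping.keys (\<Sum>q\<leftarrow>qs. q ^ 2)"
    proof (rule double_extremal_in_keys_sum_of_squares[OF p])
      fix q a b assume *: "q \<in> set qs" "a \<in> Poly_Mapping.keys q" "b \<in> Poly_Mapping.keys q" "a + b = m + m"
      then have ab: "a \<in> S" "b \<in> S" by (auto simp: S_def)
      have "deg a + deg b = 2 * k" using arg_cong[OF *(4), of deg] mT by (simp add: deg_add T_def)
      then have "a \<in> T" "b \<in> T" using ext[of "deg a" "deg b"] ab by (auto simp: T_def)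
      then have "a \<le> m" "b \<le> m" by (simp_all add: le)
      \<comment> \<open>Addition is strictly monotone in the linear order of exponents, so two
        exponents that are at most \<open>m\<close> sum to \<open>m + m\<close> only if both equal
        \<open>m\<close>.\<close>
      then show "a = m \<and> b = m" using *(4)
        by (metis add_le_cancel_left add_le_cancel_right add_mono order.antisym order_refl)
    qed
    then have "deg (m + m) = 2 * D" using hom by (simp add: homogeneous_def deg_def)
    then show "k = D" using mT by (simp add: deg_add T_def)
  qed
  have "deg e = D" if e: "e \<in> S" for e
  proof -
    have ne: "finite (deg ` S)" "deg ` S \<noteq> {}" using fin e by auto
    have "Max (deg ` S) = D"
    proof (rule layer)
      fix i j assume "i \<in> deg ` S" "j \<in> deg ` S" "i + j = 2 * Max (deg ` S)"
      moreover from this ne have "i \<le> Max (deg ` S)" "j \<le> Max (deg ` S)" by auto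
      ultimately show "i = Max (deg ` S) \<and> j = Max (deg ` S)" by linarith
    qed (use ne in \<open>rule Max_in\<close>)
    moreover have "Min (deg ` S) = D"
    proof (rule layer)
      fix i j assume "i \<in> deg ` S" "j \<in> deg ` S" "i + j = 2 * Min (deg ` S)"
      moreover from this ne have "i \<ge> Min (deg ` S)" "j \<ge> Min (deg ` S)" by auto
      ultimately show "i = Min (deg ` S) \<and> j = Min (deg ` S)" by linarith
    qed (use ne in \<open>rule Min_in\<close>)
    moreover have "deg e \<le> Max (deg ` S)" "Min (deg ` S) \<le> deg e" using ne e by auto
    ultimately show ?thesis by linarith
  qed
  then show ?thesis using assms(2) by (auto simp: homogeneous_def deg_def S_def)
qed

section \<open>Decomposition of the Gram matrix\<close>

lemma sum_double_group:
  fixes w :: "'a \<Rightarrow> real"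
  assumes "finite S"
  shows "(\<Sum>a\<in>S. \<Sum>b\<in>S. w a * w b * A (\<kappa> a) (\<kappa> b))
       = (\<Sum>s\<in>\<kappa> ` S. \<Sum>t\<in>\<kappa> ` S. A s t * (\<Sum>a\<in>{a\<in>S. \<kappa> a = s}. w a) * (\<Sum>b\<in>{b\<in>S. \<kappa> b = t}. w b))"
proof -
  have "(\<Sum>a\<in>S. \<Sum>b\<in>S. w a * w b * A (\<kappa> a) (\<kappa> b))
      = (\<Sum>s\<in>\<kappa> ` S. \<Sum>a\<in>{a\<in>S. \<kappa> a = s}. \<Sum>t\<in>\<kappa> ` S. \<Sum>b\<in>{b\<in>S. \<kappa> b = t}. w a * w b * A (\<kappa> a) (\<kappa> b))"
    by (simp only: sum.image_gen[OF assms, of _ \<kappa>])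
  also have "\<dots> = (\<Sum>s\<in>\<kappa> ` S. \<Sum>t\<in>\<kappa> ` S. \<Sum>a\<in>{a\<in>S. \<kappa> a = s}. \<Sum>b\<in>{b\<in>S. \<kappa> b = t}. w a * w b * A s t)"
    by (intro sum.cong refl, subst sum.swap) (intro sum.cong refl, simp)
  also have "\<dots> = (\<Sum>s\<in>\<kappa> ` S. \<Sum>t\<in>\<kappa> ` S. A s t * (\<Sum>a\<in>{a\<in>S. \<kappa> a = s}. w a) * (\<Sum>b\<in>{b\<in>S. \<kappa> b = t}. w b))"
    by (intro sum.cong refl) (simp add: sum_product sum_distrib_left mult_ac)
  finally show ?thesis .
qed

text \<open>With \<open>z s = u s * \<bar>v s\<bar>\<close>, the diagonal contributes at least the
  sum of the squares of \<open>z\<close>, and the other entries at least minus the mixed products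
  divided by \<open>R\<close>. Cauchy-Schwarz over at most \<open>R\<close> indices compares the
  two.\<close>

lemma scaled_diagonally_dominant_nonneg:
  fixes A :: "'a \<Rightarrow> 'a \<Rightarrow> real"
  assumes fin: "finite I" and card: "card I \<le> R" and R: "R > 0"
    and u: "\<And>s. s \<in> I \<Longrightarrow> 0 \<le> u s"
    and diag: "\<And>s. s \<in> I \<Longrightarrow> (u s)\<^sup>2 \<le> A s s"
    and off: "\<And>s t. s \<in> I \<Longrightarrow> t \<in> I \<Longrightarrow> s \<noteq> t \<Longrightarrow> \<bar>A s t\<bar> \<le> u s * u t / real R"
  shows "0 \<le> (\<Sum>s\<in>I. \<Sum>t\<in>I. A s t * v s * v t)"
proof -
  define z where "z s = u s * \<bar>v s\<bar>" for s
  have z: "0 \<le> z s" if "s \<in> I" for s using u[OF that] by (simp add: z_def)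
  \<comment> \<open>The product \<open>z s * z t / R\<close> is subtracted on the diagonal too, so
    that these products add up to the square of the sum of \<open>z\<close>, divided by
    \<open>R\<close>.\<close>
  have entry: "(if s = t then (z s)\<^sup>2 else 0) - z s * z t / real R \<le> A s t * v s * v t"
    if "s \<in> I" "t \<in> I" for s t
  proof (cases "s = t")
    case True
    have "(z s)\<^sup>2 - z s * z s / real R \<le> (z s)\<^sup>2" using z[OF that(1)] by simp
    also have "(z s)\<^sup>2 = (u s)\<^sup>2 * (v s)\<^sup>2" by (simp add: z_def power_mult_distrib)
    also have "\<dots> \<le> A s s * (v s)\<^sup>2" using diag[OF that(1)] by (intro mult_right_mono) auto
    finally show ?thesis using True by (simp add: power2_eq_square mult_ac)
  next
    case False
    have "\<bar>A s t * v s * v t\<bar> = \<bar>A s t\<bar> * (\<bar>v s\<bar> * \<bar>v t\<bar>)" by (simp add: abs_mult)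
    also have "\<dots> \<le> (u s * u t / real R) * (\<bar>v s\<bar> * \<bar>v t\<bar>)"
      using off[OF that False] by (intro mult_right_mono) auto
    also have "\<dots> = z s * z t / real R" by (simp add: z_def)
    finally show ?thesis using False by (simp add: abs_le_iff)
  qed
  have "(\<Sum>s\<in>I. z s)\<^sup>2 \<le> real (card I) * (\<Sum>s\<in>I. (z s)\<^sup>2)"
    using Cauchy_Schwarz_ineq_sum[of "\<lambda>_. 1" z I] by simp
  also have "\<dots> \<le> real R * (\<Sum>s\<in>I. (z s)\<^sup>2)"
    using card by (intro mult_right_mono sum_nonneg) auto
  finally have "0 \<le> (\<Sum>s\<in>I. (z s)\<^sup>2) - (\<Sum>s\<in>I. z s)\<^sup>2 / real R"
    using R by (simp add: field_simps)
  also have "(\<Sum>s\<in>I. z s)\<^sup>2 = (\<Sum>s\<in>I. \<Sum>t\<in>I. z s * z t)"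
    by (simp add: power2_eq_square sum_product)
  also have "(\<Sum>s\<in>I. (z s)\<^sup>2) - (\<Sum>s\<in>I. \<Sum>t\<in>I. z s * z t) / real R
      = (\<Sum>s\<in>I. \<Sum>t\<in>I. (if s = t then (z s)\<^sup>2 else 0) - z s * z t / real R)"
    using fin by (simp add: sum_subtractf sum_divide_distrib)
  also have "\<dots> \<le> (\<Sum>s\<in>I. \<Sum>t\<in>I. A s t * v s * v t)"
    by (intro sum_mono entry)
  finally show ?thesis .
qed

text \<open>Moebius inversion in the lattice of subsets: the inner sums are the inverse transform of
  \<open>F\<close>, and adding them up over all \<open>K\<close> in \<open>L\<close> restores
  \<open>F L\<close>.\<close>

lemma subset_inversion:
  fixes F :: "'a set \<Rightarrow> real"
  assumes "finite L"
  shows "F L = (\<Sum>K\<in>Pow L. \<Sum>K'\<in>Pow K. (-1) ^ (card K + card K') * F K')"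
proof -
  have "F L = (\<Sum>K\<in>Pow L. (-1) ^ card K * (\<Sum>K'\<in>Pow K. (-1) ^ card K' * F K'))"
    by (rule inclusion_exclusion_symmetric) (use assms in auto)
  then show ?thesis by (simp add: sum_distrib_left power_add mult.assoc)
qed

section \<open>Profiles of monomials and inclusion-exclusion over common variables\<close>

definition off :: "nat set \<Rightarrow> (nat \<Rightarrow>\<^sub>0 nat) \<Rightarrow> nat multiset" where
  "off K a = image_mset (Poly_Mapping.lookup a) (mset_set (Poly_Mapping.keys a - K))"

type_synonym profile = "(nat \<Rightarrow> nat) \<times> nat multiset"

text \<open>All that the Gram summand for \<open>K\<close> retains of a monomial.
  \<open>restrict\<close> fixes a default outside \<open>K\<close>, so equal exponents on
  \<open>K\<close> give equal first components.\<close>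

definition profile :: "nat set \<Rightarrow> (nat \<Rightarrow>\<^sub>0 nat) \<Rightarrow> profile" where
  "profile K a = (restrict (Poly_Mapping.lookup a) K, off K a)"

text \<open>For the profiles of two monomials whose common variables are exactly those in
  \<open>K\<close>, this is the shape of their product.\<close>

definition joint :: "nat set \<Rightarrow> profile \<Rightarrow> profile \<Rightarrow> nat multiset" where
  "joint K s t = snd s + snd t + image_mset (\<lambda>i. fst s i + fst t i) (mset_set K)"

text \<open>The Moebius inverse, over subsets \<open>K'\<close> of \<open>K\<close>, of
  \<open>n ^ card K'\<close> times \<open>g\<close> at the shape that the product would have if only
  the variables in \<open>K'\<close> were shared: the exponents on \<open>K - K'\<close> count
  separately for both factors.\<close>

definition gram :: "(nat multiset \<Rightarrow> real) \<Rightarrow> nat \<Rightarrow> nat set \<Rightarrow> profile \<Rightarrow> profile \<Rightarrow> real" where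
  "gram g n K s t = (\<Sum>K'\<in>Pow K. (-1) ^ (card K + card K') * (real n ^ card K' *
     g (snd s + image_mset (fst s) (mset_set (K - K')) + (snd t + image_mset (fst t) (mset_set (K - K')))
        + image_mset (\<lambda>i. fst s i + fst t i) (mset_set K'))))"

lemma image_mset_mset_set_Un:
  "finite A \<Longrightarrow> finite B \<Longrightarrow> A \<inter> B = {} \<Longrightarrow>
     image_mset f (mset_set (A \<union> B)) = image_mset f (mset_set A) + image_mset f (mset_set B)"
  by (simp add: mset_set_Union)

lemma image_mset_mset_set_cong:
  "(\<And>i. i \<in> A \<Longrightarrow> f i = g i) \<Longrightarrow> image_mset f (mset_set A) = image_mset g (mset_set A)"
  by (cases "finite A") (auto intro: image_mset_cong)

lemma off_subset:
  assumes "K' \<subseteq> K" "K \<subseteq> Poly_Mapping.keys a"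
  shows "off K' a = off K a + image_mset (Poly_Mapping.lookup a) (mset_set (K - K'))"
proof -
  have "Poly_Mapping.keys a - K' = (Poly_Mapping.keys a - K) \<union> (K - K')" using assms by auto
  moreover have "finite K" using assms(2) by (rule finite_subset) simp
  moreover have "(Poly_Mapping.keys a - K) \<inter> (K - K') = {}" by auto
  ultimately show ?thesis by (simp add: off_def image_mset_mset_set_Un)
qed

lemma shape_eq_off: "shape a = off {} a"
  by (simp add: shape_def off_def)

lemma shape_split: "K \<subseteq> Poly_Mapping.keys a \<Longrightarrow> shape a = off K a + image_mset (Poly_Mapping.lookup a) (mset_set K)"
  unfolding shape_eq_off using off_subset[of "{}" K a] by simp

lemma shape_add:
  fixes a b :: "nat \<Rightarrow>\<^sub>0 nat"
  defines "L \<equiv> Poly_Mapping.keys a \<inter> Poly_Mapping.keys b"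
  shows "shape (a + b) = off L a + off L b + image_mset (\<lambda>i. Poly_Mapping.lookup a i + Poly_Mapping.lookup b i) (mset_set L)"
proof -
  let ?f = "\<lambda>i. Poly_Mapping.lookup a i + Poly_Mapping.lookup b i"
  have "Poly_Mapping.keys (a + b) = ((Poly_Mapping.keys a - L) \<union> (Poly_Mapping.keys b - L)) \<union> L"
    by (auto simp: keys_add_nat L_def)
  then have "shape (a + b) = image_mset ?f (mset_set (Poly_Mapping.keys a - L)) + image_mset ?f (mset_set (Poly_Mapping.keys b - L))
      + image_mset ?f (mset_set L)"
    unfolding shape_def lookup_add[abs_def] L_def
    by (subst image_mset_mset_set_Un[symmetric], simp, simp, blast)+ (simp add: lookup_add)
  moreover have "image_mset ?f (mset_set (Poly_Mapping.keys a - L)) = off L a"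
    unfolding off_def by (intro image_mset_mset_set_cong) (auto simp: L_def in_keys_iff)
  moreover have "image_mset ?f (mset_set (Poly_Mapping.keys b - L)) = off L b"
    unfolding off_def by (intro image_mset_mset_set_cong) (auto simp: L_def in_keys_iff)
  ultimately show ?thesis by simp
qed

lemma gram_profile:
  assumes "K \<subseteq> Poly_Mapping.keys a" "K \<subseteq> Poly_Mapping.keys b"
  shows "gram g n K (profile K a) (profile K b) = (\<Sum>K'\<in>Pow K. (-1) ^ (card K + card K') * (real n ^ card K' *
     g (off K' a + off K' b + image_mset (\<lambda>i. Poly_Mapping.lookup a i + Poly_Mapping.lookup b i) (mset_set K'))))"
  unfolding gram_def
proof (rule sum.cong[OF refl])
  fix K' assume "K' \<in> Pow K"
  then have K': "K' \<subseteq> K" by simp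
  have 1: "image_mset (fst (profile K c)) (mset_set (K - K')) = image_mset (Poly_Mapping.lookup c) (mset_set (K - K'))" for c
    by (intro image_mset_mset_set_cong) (auto simp: profile_def)
  have 2: "image_mset (\<lambda>i. fst (profile K a) i + fst (profile K b) i) (mset_set K')
      = image_mset (\<lambda>i. Poly_Mapping.lookup a i + Poly_Mapping.lookup b i) (mset_set K')"
    using K' by (intro image_mset_mset_set_cong) (auto simp: profile_def)
  have 3: "snd (profile K a) + image_mset (Poly_Mapping.lookup a) (mset_set (K - K')) = off K' a"
    "snd (profile K b) + image_mset (Poly_Mapping.lookup b) (mset_set (K - K')) = off K' b"
    by (simp_all add: profile_def off_subset[OF K' assms(1)] off_subset[OF K' assms(2)])
  show "(-1) ^ (card K + card K') * (real n ^ card K' *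
     g (snd (profile K a) + image_mset (fst (profile K a)) (mset_set (K - K'))
        + (snd (profile K b) + image_mset (fst (profile K b)) (mset_set (K - K')))
        + image_mset (\<lambda>i. fst (profile K a) i + fst (profile K b) i) (mset_set K')))
     = (-1) ^ (card K + card K') * (real n ^ card K' *
     g (off K' a + off K' b + image_mset (\<lambda>i. Poly_Mapping.lookup a i + Poly_Mapping.lookup b i) (mset_set K')))"
    unfolding 1 2 3 ..
qed

text \<open>The support of \<open>a + b\<close> has the sizes of both supports minus that of their
  intersection. Hence the weight is \<open>n ^ card ?L * g\<close> divided by one factor for
  \<open>a\<close> and one for \<open>b\<close>, and subset inversion at \<open>?L\<close> expands
  the numerator.\<close>

lemma weight_eq_sum_gram:
  assumes n: "n > 0"
  shows "g (shape (a + b)) / real n ^ card (Poly_Mapping.keys (a + b))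
    = (\<Sum>K\<in>Pow (Poly_Mapping.keys a \<inter> Poly_Mapping.keys b). gram g n K (profile K a) (profile K b))
        / (real n ^ card (Poly_Mapping.keys a) * real n ^ card (Poly_Mapping.keys b))"
proof -
  let ?L = "Poly_Mapping.keys a \<inter> Poly_Mapping.keys b"
  define F where "F K = real n ^ card K *
    g (off K a + off K b + image_mset (\<lambda>i. Poly_Mapping.lookup a i + Poly_Mapping.lookup b i) (mset_set K))" for K
  have "card (Poly_Mapping.keys (a + b)) + card ?L = card (Poly_Mapping.keys a) + card (Poly_Mapping.keys b)"
    by (simp add: keys_add_nat card_Un_Int[of "Poly_Mapping.keys a" "Poly_Mapping.keys b"])
  then have pow: "real n ^ card (Poly_Mapping.keys (a + b)) * real n ^ card ?L = real n ^ card (Poly_Mapping.keys a) * real n ^ card (Poly_Mapping.keys b)"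
    by (simp flip: power_add)
  have "(\<Sum>K\<in>Pow ?L. gram g n K (profile K a) (profile K b))
      = (\<Sum>K\<in>Pow ?L. \<Sum>K'\<in>Pow K. (-1) ^ (card K + card K') * F K')"
    by (intro sum.cong refl, subst gram_profile) (auto simp: F_def)
  also have "\<dots> = F ?L" by (rule subset_inversion[symmetric]) simp
  also have "\<dots> = real n ^ card ?L * g (shape (a + b))"
    unfolding F_def shape_add ..
  finally show ?thesis using n by (simp add: field_simps flip: pow)
qed

text \<open>The summand for \<open>K' = K\<close> is the main term; the fewer than
  \<open>2 ^ d\<close> others have a smaller power of \<open>n\<close>.\<close>

lemma gram_approx:
  assumes n: "n > 0" and G: "\<And>\<mu>. \<bar>g \<mu>\<bar> \<le> G" and K: "finite K" "card K \<le> d"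
  shows "\<bar>gram g n K s t - real n ^ card K * g (joint K s t)\<bar> \<le> real n ^ card K * (2 ^ d * G / real n)"
proof -
  define T where "T K' = (-1) ^ (card K + card K') * (real n ^ card K' *
     g (snd s + image_mset (fst s) (mset_set (K - K')) + (snd t + image_mset (fst t) (mset_set (K - K')))
        + image_mset (\<lambda>i. fst s i + fst t i) (mset_set K')))" for K'
  have G0: "0 \<le> G" using G[of "{#}"] by linarith
  have "T K = real n ^ card K * g (joint K s t)"
    by (simp add: T_def joint_def flip: mult_2)
  moreover have "gram g n K s t = T K + (\<Sum>K'\<in>Pow K - {K}. T K')"
    unfolding gram_def T_def[symmetric] using K(1) by (intro sum.remove) auto
  ultimately have "\<bar>gram g n K s t - real n ^ card K * g (joint K s t)\<bar> = \<bar>\<Sum>K'\<in>Pow K - {K}. T K'\<bar>"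
    by simp
  also have "\<dots> \<le> (\<Sum>K'\<in>Pow K - {K}. \<bar>T K'\<bar>)" by (rule sum_abs)
  also have "\<dots> \<le> (\<Sum>K'\<in>Pow K - {K}. real n ^ card K * (G / real n))"
  proof (rule sum_mono)
    fix K' assume "K' \<in> Pow K - {K}"
    then have "card K' < card K" using K(1) by (intro psubset_card_mono) auto
    then have "real n ^ Suc (card K') \<le> real n ^ card K" using n by (intro power_increasing) auto
    then have *: "real n ^ card K' \<le> real n ^ card K / real n" using n by (simp add: field_simps)
    have "\<bar>T K'\<bar> \<le> real n ^ card K' * G"
      unfolding T_def by (simp add: abs_mult power_abs mult_left_mono G)
    also have "\<dots> \<le> real n ^ card K / real n * G" using * G0 by (rule mult_right_mono)
    finally show "\<bar>T K'\<bar> \<le> real n ^ card K * (G / real n)" by simp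
  qed
  also have "\<dots> = real (card (Pow K - {K})) * (real n ^ card K * (G / real n))" by simp
  also have "\<dots> \<le> 2 ^ d * (real n ^ card K * (G / real n))"
  proof (rule mult_right_mono)
    have "card (Pow K - {K}) \<le> card (Pow K)" using K(1) by (intro card_mono) auto
    also have "\<dots> = 2 ^ card K" using K(1) by (rule card_Pow)
    also have "\<dots> \<le> 2 ^ d" using K(2) by (intro power_increasing) auto
    finally show "real (card (Pow K - {K})) \<le> 2 ^ d"
      by (metis numeral_power_le_of_nat_cancel_iff of_nat_le_iff of_nat_numeral of_nat_power)
  qed (use G0 in auto)
  finally show ?thesis by (simp add: mult_ac)
qed

text \<open>Bounds the number of profiles of monomials of degree \<open>d\<close> uniformly in
  \<open>n\<close>: exponents at most \<open>d\<close> on at most \<open>d\<close> variables of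
  \<open>K\<close>, and off \<open>K\<close> a partition of some \<open>m \<le> d\<close>.\<close>

definition profile_bound :: "nat \<Rightarrow> nat" where
  "profile_bound d = (d + 1) ^ d * card (\<Union>m\<le>d. partitions m)"

lemma profile_bound_pos: "profile_bound d > 0"
proof -
  have "{#} \<in> (\<Union>m\<le>d. partitions m)" by (auto simp: partitions_def)
  moreover have "finite (\<Union>m\<le>d. partitions m)" by (simp add: finite_partitions)
  ultimately have "card (\<Union>m\<le>d. partitions m) > 0" by (auto simp: card_gt_0_iff)
  then show ?thesis by (simp add: profile_bound_def)
qed

lemma card_profiles:
  assumes S: "\<And>a. a \<in> S \<Longrightarrow> K \<subseteq> Poly_Mapping.keys a \<and> sum_mset (shape a) = d" and K: "finite K" "card K \<le> d"
  shows "finite (profile K ` S)" "card (profile K ` S) \<le> profile_bound d"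
proof -
  let ?B = "(K \<rightarrow>\<^sub>E {..d}) \<times> (\<Union>m\<le>d. partitions m)"
  have fin: "finite ?B" using K(1) by (intro finite_cartesian_product finite_PiE) (auto simp: finite_partitions)
  have sub: "profile K ` S \<subseteq> ?B"
  proof
    fix s assume "s \<in> profile K ` S"
    then obtain a where a: "a \<in> S" "s = profile K a" by auto
    have "Poly_Mapping.lookup a i \<le> d" if "i \<in> K" for i
    proof -
      have "Poly_Mapping.lookup a i \<in># shape a" using S[OF a(1)] that by (auto simp: shape_def)
      then show ?thesis using S[OF a(1)] by (metis sum_mset.remove le_add1)
    qed
    moreover have "sum_mset (off K a) \<le> d"
      using S[OF a(1)] shape_split[of K a] by (metis le_add1 sum_mset.union)
    moreover have "0 \<notin># off K a" by (auto simp: off_def in_keys_iff)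
    ultimately show "s \<in> ?B" by (auto simp: a(2) profile_def partitions_def)
  qed
  show "finite (profile K ` S)" using sub fin by (rule finite_subset)
  have "card (profile K ` S) \<le> card ?B" using fin sub by (rule card_mono)
  also have "\<dots> = (d + 1) ^ card K * card (\<Union>m\<le>d. partitions m)"
    using K(1) by (simp add: card_cartesian_product card_PiE)
  also have "\<dots> \<le> profile_bound d"
    unfolding profile_bound_def using K(2) by (intro mult_right_mono power_increasing) auto
  finally show "card (profile K ` S) \<le> profile_bound d" .
qed

section \<open>Positivity and the second inclusion\<close>

text \<open>The last condition makes the limit matrix \<open>g (joint K s t)\<close> diagonally
  dominant with room to spare. In the margin \<open>4 * profile_bound d\<close>, one factor 2 pays
  for halving the diagonal, the other for the error at finite \<open>n\<close> off the
  diagonal.\<close>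

definition gapped :: "nat \<Rightarrow> (nat multiset \<Rightarrow> real) \<Rightarrow> bool" where
  "gapped d g \<longleftrightarrow>
     (\<forall>\<mu>. \<mu> \<notin> even_partitions (2 * d) \<longrightarrow> g \<mu> = 0) \<and>
     (\<forall>\<mu> \<in> even_partitions (2 * d). g \<mu> > 0) \<and>
     (\<forall>K s t. finite K \<longrightarrow> fst s \<in> extensional K \<longrightarrow> fst t \<in> extensional K \<longrightarrow> s \<noteq> t \<longrightarrow>
        joint K s s \<in> even_partitions (2 * d) \<longrightarrow> joint K t t \<in> even_partitions (2 * d) \<longrightarrow>
        joint K s t \<in> even_partitions (2 * d) \<longrightarrow>
        4 * real (profile_bound d) * g (joint K s t) \<le> sqrt (g (joint K s s) * g (joint K t t)))"

text \<open>The doubled exponents on \<open>K\<close> are even and the degree is right, so the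
  failure comes from an odd exponent \<open>r\<close> off \<open>K\<close>. It stays a part of its
  own in the summand for every \<open>K'\<close>, where \<open>g\<close> therefore vanishes.\<close>

lemma gram_profile_eq_zero:
  assumes g: "gapped d g" and a: "K \<subseteq> Poly_Mapping.keys a" "sum_mset (shape a) = d"
    and na: "joint K (profile K a) (profile K a) \<notin> even_partitions (2 * d)"
    and b: "K \<subseteq> Poly_Mapping.keys b"
  shows "gram g n K (profile K a) (profile K b) = 0" and "gram g n K (profile K b) (profile K a) = 0"
proof -
  let ?J = "joint K (profile K a) (profile K a)"
  have im: "image_mset (\<lambda>i. fst (profile K a) i + fst (profile K a) i) (mset_set K)
      = image_mset (\<lambda>i. Poly_Mapping.lookup a i + Poly_Mapping.lookup a i) (mset_set K)"
    by (intro image_mset_mset_set_cong) (auto simp: profile_def)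
  have J: "?J = off K a + off K a + image_mset (\<lambda>i. Poly_Mapping.lookup a i + Poly_Mapping.lookup a i) (mset_set K)"
    unfolding joint_def im by (simp add: profile_def)
  have fin: "finite K" using a(1) by (rule finite_subset) simp
  have "sum_mset ?J = 2 * sum_mset (shape a)"
    unfolding J shape_split[OF a(1)] by (simp add: sum_mset.distrib)
  moreover have "0 \<notin># ?J"
    using a(1) fin by (auto simp: J off_def in_keys_iff)
  ultimately have "\<not> (\<forall>r\<in>#?J. even r)"
    using na a(2) by (auto simp: even_partitions_def partitions_def)
  then obtain r where r: "r \<in># off K a" "odd r"
    using fin by (auto simp: J)
  have zero: "g (off K' a + off K' b + X) = 0" "g (off K' b + off K' a + X) = 0" if "K' \<subseteq> K" for K' X
  proof -
    have "r \<in># off K' a" using r(1) off_subset[OF that a(1)] by simp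
    then have "off K' a + off K' b + X \<notin> even_partitions (2 * d)"
      "off K' b + off K' a + X \<notin> even_partitions (2 * d)"
      using r(2) by (auto simp: even_partitions_def)
    then show "g (off K' a + off K' b + X) = 0" "g (off K' b + off K' a + X) = 0"
      using g by (auto simp: gapped_def)
  qed
  show "gram g n K (profile K a) (profile K b) = 0" "gram g n K (profile K b) (profile K a) = 0"
    using a(1) b by (auto simp: gram_profile zero intro!: sum.neutral)
qed

text \<open>Monomials with an odd exponent off \<open>K\<close> give zero rows. The others are
  grouped by profile, and the resulting matrix is so close to
  \<open>n ^ card K * g (joint K s t)\<close> that it inherits diagonal dominance.\<close>

lemma gram_form_nonneg:
  assumes g: "gapped d g" and n: "n > 0" and G: "\<And>\<mu>. \<bar>g \<mu>\<bar> \<le> G"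
    and gm: "gm > 0" "\<And>\<mu>. \<mu> \<in> even_partitions (2 * d) \<Longrightarrow> gm \<le> g \<mu>"
    and large: "2 ^ d * G / real n \<le> gm / (4 * real (profile_bound d))"
    and S: "finite S" "\<And>a. a \<in> S \<Longrightarrow> K \<subseteq> Poly_Mapping.keys a \<and> sum_mset (shape a) = d"
  shows "0 \<le> (\<Sum>a\<in>S. \<Sum>b\<in>S. w a * w b * gram g n K (profile K a) (profile K b))"
proof (cases "S = {}")
  case False
  then obtain a0 where a0: "a0 \<in> S" by blast
  have fin: "finite K" using S(2)[OF a0] by (meson finite_keys finite_subset)
  have "card K \<le> card (Poly_Mapping.keys a0)" using S(2)[OF a0] by (intro card_mono) auto
  also have "\<dots> \<le> d"
    using size_le_sum_mset[OF zero_notin_shape, of a0] S(2)[OF a0] by (simp add: size_shape)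
  finally have cK: "card K \<le> d" .
  let ?R = "real (profile_bound d)" and ?P = "real n ^ card K"
  have R: "profile_bound d > 0" by (rule profile_bound_pos)
  then have R1: "?R \<ge> 1" by linarith
  have P: "?P > 0" using n by simp
  define \<delta> where "\<delta> = gm / (4 * ?R)"
  have \<delta>: "0 \<le> \<delta>" "\<delta> \<le> gm / 4"
    using gm(1) R1 frac_le[of gm gm 4 "4 * ?R"] by (simp_all add: \<delta>_def)
  have approx: "\<bar>gram g n K s t - ?P * g (joint K s t)\<bar> \<le> ?P * \<delta>" for s t
  proof -
    have "\<bar>gram g n K s t - ?P * g (joint K s t)\<bar> \<le> ?P * (2 ^ d * G / real n)"
      by (rule gram_approx[OF n G fin cK])
    also have "\<dots> \<le> ?P * \<delta>" using large P unfolding \<delta>_def by (intro mult_left_mono) auto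
    finally show ?thesis .
  qed
  define S' where "S' = {a \<in> S. joint K (profile K a) (profile K a) \<in> even_partitions (2 * d)}"
  have S': "finite S'" "S' \<subseteq> S" using S(1) by (auto simp: S'_def)
  \<comment> \<open>Only half of the leading diagonal term is claimed; the other half absorbs the
    error \<open>\<delta>\<close>.\<close>
  define u where "u s = sqrt (?P * g (joint K s s) / 2)" for s
  have EP: "joint K s s \<in> even_partitions (2 * d)" if "s \<in> profile K ` S'" for s
    using that by (auto simp: S'_def)
  have gpos: "g (joint K s s) > 0" if "s \<in> profile K ` S'" for s
    using g EP[OF that] by (auto simp: gapped_def)
  have drop: "gram g n K (profile K a) (profile K b) = 0" if "a \<in> S" "b \<in> S" "a \<notin> S' \<or> b \<notin> S'" for a b
    using that S(2)[OF that(1)] S(2)[OF that(2)] gram_profile_eq_zero[OF g] by (auto simp: S'_def)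
  have "(\<Sum>a\<in>S. \<Sum>b\<in>S. w a * w b * gram g n K (profile K a) (profile K b))
      = (\<Sum>a\<in>S'. \<Sum>b\<in>S. w a * w b * gram g n K (profile K a) (profile K b))"
    using S(1) S'(2) drop by (intro sum.mono_neutral_right) (auto intro!: sum.neutral)
  also have "\<dots> = (\<Sum>a\<in>S'. \<Sum>b\<in>S'. w a * w b * gram g n K (profile K a) (profile K b))"
    using S(1) S'(2) drop by (intro sum.cong refl sum.mono_neutral_right) auto
  also have "\<dots> = (\<Sum>s\<in>profile K ` S'. \<Sum>t\<in>profile K ` S'. gram g n K s t *
      (\<Sum>a\<in>{a\<in>S'. profile K a = s}. w a) * (\<Sum>b\<in>{b\<in>S'. profile K b = t}. w b))"
    by (rule sum_double_group[OF S'(1)])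
  also have "0 \<le> \<dots>"
  proof (rule scaled_diagonally_dominant_nonneg[where R = "profile_bound d" and u = u])
    show "finite (profile K ` S')" using S'(1) by simp
    show "card (profile K ` S') \<le> profile_bound d"
      using card_profiles[of S' K d] S(2) S'(2) fin cK by blast
    show "0 < profile_bound d" by (rule R)
  next
    fix s assume s: "s \<in> profile K ` S'"
    show "0 \<le> u s" using P gpos[OF s] by (simp add: u_def)
    have "\<delta> \<le> g (joint K s s) / 2" using \<delta>(2) gm(2)[OF EP[OF s]] gm(1) by linarith
    then have "?P * \<delta> \<le> ?P * (g (joint K s s) / 2)" using P by (intro mult_left_mono) auto
    moreover have "(u s)\<^sup>2 = ?P * (g (joint K s s) / 2)"
      using P gpos[OF s] by (simp add: u_def)
    ultimately show "(u s)\<^sup>2 \<le> gram g n K s s" using approx[of s s] by (simp add: abs_le_iff)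
  next
    fix s t assume s: "s \<in> profile K ` S'" and t: "t \<in> profile K ` S'" and st: "s \<noteq> t"
    let ?q = "sqrt (g (joint K s s) * g (joint K t t))"
    have uu: "u s * u t = ?P * ?q / 2"
    proof -
      have "u s * u t = sqrt (?P\<^sup>2 * (g (joint K s s) * g (joint K t t)) / 2\<^sup>2)"
        by (simp add: u_def power2_eq_square mult_ac flip: real_sqrt_mult)
      then show ?thesis using P by (simp add: real_sqrt_mult real_sqrt_divide)
    qed
    have "gm = sqrt (gm * gm)" using gm(1) by simp
    also have "\<dots> \<le> ?q"
      using gm EP[OF s] EP[OF t] by (intro real_sqrt_le_mono mult_mono) (auto intro: order.trans[of 0 gm])
    finally have "\<delta> \<le> ?q / (4 * ?R)" unfolding \<delta>_def using R by (intro divide_right_mono) auto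
    moreover have "\<bar>g (joint K s t)\<bar> \<le> ?q / (4 * ?R)"
    proof (cases "joint K s t \<in> even_partitions (2 * d)")
      case True
      have "fst s \<in> extensional K" "fst t \<in> extensional K" using s t by (auto simp: profile_def)
      then have "4 * ?R * g (joint K s t) \<le> ?q"
        using g fin st True EP[OF s] EP[OF t] unfolding gapped_def by blast
      moreover have "g (joint K s t) > 0" using True g by (auto simp: gapped_def)
      ultimately show ?thesis using R by (simp add: field_simps)
    next
      case False
      then have "g (joint K s t) = 0" using g by (auto simp: gapped_def)
      then show ?thesis using gpos[OF s] gpos[OF t] by simp
    qed
    \<comment> \<open>The entry and the error each take a quarter of \<open>?q / ?R\<close>;
      together they meet the bound \<open>u s * u t / ?R\<close>, in which the halved diagonal
      leaves one half.\<close>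
    ultimately have "\<bar>g (joint K s t)\<bar> + \<delta> \<le> ?q / (2 * ?R)" by (simp add: field_simps)
    then have "?P * (\<bar>g (joint K s t)\<bar> + \<delta>) \<le> ?P * (?q / (2 * ?R))" using P by (intro mult_left_mono) auto
    moreover have "\<bar>gram g n K s t\<bar> \<le> ?P * (\<bar>g (joint K s t)\<bar> + \<delta>)"
    proof -
      have "\<bar>gram g n K s t\<bar> \<le> \<bar>?P * g (joint K s t)\<bar> + ?P * \<delta>" using approx[of s t] by linarith
      then show ?thesis using P by (simp add: abs_mult distrib_left)
    qed
    ultimately have "\<bar>gram g n K s t\<bar> \<le> ?P * (?q / (2 * ?R))" by linarith
    then show "\<bar>gram g n K s t\<bar> \<le> u s * u t / ?R" by (simp add: uu mult_ac)
  qed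
  finally show ?thesis .
qed simp

text \<open>After an exchange of sums, each set \<open>K\<close> of variables contributes the form
  of its Gram matrix on the monomials containing \<open>K\<close>, and each of these forms is
  nonnegative.\<close>

lemma functional_square_nonneg:
  assumes g: "gapped d g" and n: "n > 0" and G: "\<And>\<mu>. \<bar>g \<mu>\<bar> \<le> G"
    and gm: "gm > 0" "\<And>\<mu>. \<mu> \<in> even_partitions (2 * d) \<Longrightarrow> gm \<le> g \<mu>"
    and large: "2 ^ d * G / real n \<le> gm / (4 * real (profile_bound d))"
    and q: "q \<in> polys_in n" "homogeneous d q"
  shows "0 \<le> functional (\<lambda>e. g (shape e) / real n ^ card (Poly_Mapping.keys e)) (q ^ 2)"
proof -
  \<comment> \<open>The denominators that belong to \<open>a\<close> and \<open>b\<close> separately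
    are absorbed into the coefficients.\<close>
  define w where "w a = Poly_Mapping.lookup q a / real n ^ card (Poly_Mapping.keys a)" for a
  let ?D = "\<lambda>K a b. gram g n K (profile K a) (profile K b)"
  let ?S = "\<lambda>K. {a \<in> Poly_Mapping.keys q. K \<subseteq> Poly_Mapping.keys a}"
  \<comment> \<open>With \<open>K\<close> ranging over all subsets of \<open>{1..n}\<close> under a
    condition, the index set no longer depends on \<open>a\<close> and \<open>b\<close>, so the sums
    can be exchanged.\<close>
  have entry: "Poly_Mapping.lookup q a * Poly_Mapping.lookup q b * (g (shape (a + b)) / real n ^ card (Poly_Mapping.keys (a + b)))
      = (\<Sum>K\<in>Pow {1..n}. if K \<subseteq> Poly_Mapping.keys a \<and> K \<subseteq> Poly_Mapping.keys b then w a * w b * ?D K a b else 0)"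
    if "a \<in> Poly_Mapping.keys q" for a b
  proof -
    have "Poly_Mapping.keys a \<subseteq> {1..n}" using q(1) that by (auto simp: polys_in_def)
    then have Pow: "Pow (Poly_Mapping.keys a \<inter> Poly_Mapping.keys b) = {K \<in> Pow {1..n}. K \<subseteq> Poly_Mapping.keys a \<and> K \<subseteq> Poly_Mapping.keys b}" by auto
    have "(\<Sum>K\<in>Pow {1..n}. if K \<subseteq> Poly_Mapping.keys a \<and> K \<subseteq> Poly_Mapping.keys b then w a * w b * ?D K a b else 0)
        = (\<Sum>K\<in>Pow (Poly_Mapping.keys a \<inter> Poly_Mapping.keys b). w a * w b * ?D K a b)"
      unfolding Pow by (rule sum.inter_filter[symmetric]) simp
    then show ?thesis
      unfolding weight_eq_sum_gram[OF n] w_def by (simp add: sum_distrib_left sum_divide_distrib)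
  qed
  have "functional (\<lambda>e. g (shape e) / real n ^ card (Poly_Mapping.keys e)) (q ^ 2)
      = (\<Sum>a\<in>Poly_Mapping.keys q. \<Sum>b\<in>Poly_Mapping.keys q. \<Sum>K\<in>Pow {1..n}.
          if K \<subseteq> Poly_Mapping.keys a \<and> K \<subseteq> Poly_Mapping.keys b then w a * w b * ?D K a b else 0)"
    unfolding power2_eq_square functional_mult by (intro sum.cong refl entry)
  also have "\<dots> = (\<Sum>K\<in>Pow {1..n}. \<Sum>a\<in>Poly_Mapping.keys q. \<Sum>b\<in>Poly_Mapping.keys q.
          if K \<subseteq> Poly_Mapping.keys a \<and> K \<subseteq> Poly_Mapping.keys b then w a * w b * ?D K a b else 0)"
    by (subst sum.swap) (subst (2) sum.swap, simp)
  also have "\<dots> = (\<Sum>K\<in>Pow {1..n}. \<Sum>a\<in>?S K. \<Sum>b\<in>?S K. w a * w b * ?D K a b)"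
  proof (rule sum.cong[OF refl])
    fix K
    have "(\<Sum>a\<in>?S K. \<Sum>b\<in>?S K. w a * w b * ?D K a b)
      = (\<Sum>a\<in>Poly_Mapping.keys q. if K \<subseteq> Poly_Mapping.keys a then \<Sum>b\<in>Poly_Mapping.keys q. if K \<subseteq> Poly_Mapping.keys b then w a * w b * ?D K a b else 0 else 0)"
      by (simp add: sum.inter_filter)
    also have "\<dots> = (\<Sum>a\<in>Poly_Mapping.keys q. \<Sum>b\<in>Poly_Mapping.keys q.
          if K \<subseteq> Poly_Mapping.keys a \<and> K \<subseteq> Poly_Mapping.keys b then w a * w b * ?D K a b else 0)"
      by (intro sum.cong refl) auto
    finally show "(\<Sum>a\<in>Poly_Mapping.keys q. \<Sum>b\<in>Poly_Mapping.keys q.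
          if K \<subseteq> Poly_Mapping.keys a \<and> K \<subseteq> Poly_Mapping.keys b then w a * w b * ?D K a b else 0)
        = (\<Sum>a\<in>?S K. \<Sum>b\<in>?S K. w a * w b * ?D K a b)" by simp
  qed
  also have "0 \<le> \<dots>"
    using q(2) by (intro sum_nonneg gram_form_nonneg[OF g n G gm large]) (auto simp: homogeneous_def)
  finally show ?thesis .
qed

section \<open>A strictly convex perturbation\<close>

definition sum_sq :: "nat multiset \<Rightarrow> real" where
  "sum_sq \<mu> = (\<Sum>r\<in>#\<mu>. (real r)\<^sup>2)"

definition mult_sq :: "nat \<Rightarrow> nat multiset \<Rightarrow> real" where
  "mult_sq N \<mu> = (\<Sum>r\<le>N. (real (count \<mu> r))\<^sup>2)"

text \<open>
  Strictly convex along \<^const>\<open>joint\<close>: the first term separates the exponents on \<open>K\<close>, the second one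
  the remaining multisets.
\<close>

definition weight :: "nat \<Rightarrow> nat multiset \<Rightarrow> real" where
  "weight N \<mu> = (real N + 1) ^ 3 * sum_sq \<mu> + mult_sq N \<mu>"

lemma sum_sq_nonneg: "0 \<le> sum_sq \<mu>"
  unfolding sum_sq_def by (induction \<mu>) auto

lemma mult_sq_nonneg: "0 \<le> mult_sq N \<mu>"
  by (simp add: mult_sq_def sum_nonneg)

lemma weight_nonneg: "0 \<le> weight N \<mu>"
  by (simp add: weight_def sum_sq_nonneg mult_sq_nonneg)

lemma sum_sq_joint:
  "sum_sq (joint K s t) = sum_sq (snd s) + sum_sq (snd t) + (\<Sum>i\<in>K. (real (fst s i) + real (fst t i))\<^sup>2)"
  by (simp add: joint_def sum_sq_def sum_unfold_sum_mset image_mset.compositionality comp_def)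

text \<open>The identity \<open>(2 x)^2 + (2 y)^2 - 2 (x + y)^2 = 2 (x - y)^2\<close> for each
  variable in \<open>K\<close>; the parts off \<open>K\<close> enter additively and cancel.\<close>

lemma sum_sq_gap:
  "sum_sq (joint K s s) + sum_sq (joint K t t) - 2 * sum_sq (joint K s t)
     = 2 * (\<Sum>i\<in>K. (real (fst s i) - real (fst t i))\<^sup>2)"
proof -
  have "(\<Sum>i\<in>K. (real (fst s i) + real (fst s i))\<^sup>2) + (\<Sum>i\<in>K. (real (fst t i) + real (fst t i))\<^sup>2)
      - 2 * (\<Sum>i\<in>K. (real (fst s i) + real (fst t i))\<^sup>2) = 2 * (\<Sum>i\<in>K. (real (fst s i) - real (fst t i))\<^sup>2)"
    unfolding sum_distrib_left sum.distrib[symmetric] sum_subtractf[symmetric]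
    by (intro sum.cong refl) (simp add: power2_eq_square algebra_simps)
  then show ?thesis unfolding sum_sq_joint by simp
qed

lemma one_le_sum_sq_diff:
  fixes x y :: "'a \<Rightarrow> nat"
  assumes "finite I" "i \<in> I" "x i \<noteq> y i"
  shows "1 \<le> (\<Sum>i\<in>I. (real (x i) - real (y i))\<^sup>2)"
proof -
  have "\<bar>real (x i) - real (y i)\<bar> \<ge> 1" using assms(3) by linarith
  then have "1 \<le> (real (x i) - real (y i))\<^sup>2" by (simp add: abs_le_square_iff[of 1, simplified])
  also have "\<dots> \<le> (\<Sum>i\<in>I. (real (x i) - real (y i))\<^sup>2)"
    using assms by (intro member_le_sum) auto
  finally show ?thesis .
qed

text \<open>There are \<open>N + 1\<close> multiplicities, each at most \<open>N\<close>. The bound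
  is the factor of \<open>sum_sq\<close> in \<open>weight\<close>, so a gap in \<open>sum_sq\<close>
  outweighs any loss in \<open>mult_sq\<close>.\<close>

lemma mult_sq_le:
  assumes "\<mu> \<in> partitions N"
  shows "mult_sq N \<mu> + 1 \<le> (real N + 1) ^ 3"
proof -
  have "count \<mu> r \<le> N" for r
    using assms size_le_sum_mset[of \<mu>] count_le_size[of \<mu> r] by (auto simp: partitions_def)
  then have "mult_sq N \<mu> \<le> (\<Sum>r\<le>N. (real N)\<^sup>2)"
    unfolding mult_sq_def by (intro sum_mono power_mono) auto
  then have "mult_sq N \<mu> \<le> (real N) ^ 3 + (real N)\<^sup>2"
    by (simp add: power3_eq_cube power2_eq_square algebra_simps)
  moreover have "(real N + 1) ^ 3 = (real N) ^ 3 + 3 * (real N)\<^sup>2 + 3 * real N + 1"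
    by (simp add: power3_eq_cube power2_eq_square algebra_simps)
  moreover have "(real N)\<^sup>2 \<ge> 0" "real N \<ge> 0" by simp_all
  ultimately show ?thesis by linarith
qed

lemma partitions_part_le: "\<mu> \<in> partitions N \<Longrightarrow> r \<in># \<mu> \<Longrightarrow> r \<le> N"
  unfolding partitions_def by (metis (mono_tags, lifting) le_add1 mem_Collect_eq sum_mset.remove)

text \<open>All data are integers, so distinct profiles differ somewhere by at least 1, and strict
  convexity yields a gap independent of the profiles.\<close>

lemma weight_gap:
  assumes K: "finite K" and ext: "fst s \<in> extensional K" "fst t \<in> extensional K" and st: "s \<noteq> t"
    and EP: "joint K s s \<in> even_partitions N" "joint K t t \<in> even_partitions N" "joint K s t \<in> even_partitions N"
  shows "2 * weight N (joint K s t) + 1 \<le> weight N (joint K s s) + weight N (joint K t t)"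
proof (cases "fst s = fst t")
  case False
  then obtain i where i: "i \<in> K" "fst s i \<noteq> fst t i" using ext by (meson extensionalityI)
  let ?B = "(real N + 1) ^ 3"
  have "2 \<le> sum_sq (joint K s s) + sum_sq (joint K t t) - 2 * sum_sq (joint K s t)"
    unfolding sum_sq_gap using one_le_sum_sq_diff[of K i "fst s" "fst t"] K i by linarith
  then have "?B * 2 \<le> ?B * (sum_sq (joint K s s) + sum_sq (joint K t t) - 2 * sum_sq (joint K s t))"
    by (intro mult_left_mono) auto
  moreover have "mult_sq N (joint K s t) + 1 \<le> ?B"
    using EP(3) by (intro mult_sq_le) (simp add: even_partitions_def)
  ultimately show ?thesis
    using mult_sq_nonneg[of N "joint K s s"] mult_sq_nonneg[of N "joint K t t"]
    unfolding weight_def by (simp add: algebra_simps)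
next
  \<comment> \<open>With equal exponents on \<open>K\<close>, the multiplicities in
    \<open>joint\<close> are sums of those off \<open>K\<close> plus a common term, so the identity
    for squares applies to them.\<close>
  case eq: True
  with st have "snd s \<noteq> snd t" by (simp add: prod_eq_iff)
  then obtain r where r: "count (snd s) r \<noteq> count (snd t) r" by (auto simp: multiset_eq_iff)
  \<comment> \<open>\<open>mult_sq\<close> sees only parts up to \<open>N\<close>, so
    \<open>r\<close> has to be located in a partition of \<open>N\<close>.\<close>
  have "r \<in># joint K s s \<or> r \<in># joint K t t"
    using r by (auto simp: joint_def count_eq_zero_iff) (metis count_eq_zero_iff)+
  then have rN: "r \<le> N" using EP by (auto simp: even_partitions_def dest: partitions_part_le)
  have "(\<Sum>r\<le>N. (real (count (joint K s s) r))\<^sup>2) + (\<Sum>r\<le>N. (real (count (joint K t t) r))\<^sup>2)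
      - 2 * (\<Sum>r\<le>N. (real (count (joint K s t) r))\<^sup>2)
      = 2 * (\<Sum>r\<le>N. (real (count (snd s) r) - real (count (snd t) r))\<^sup>2)"
    unfolding sum_distrib_left sum.distrib[symmetric] sum_subtractf[symmetric]
    by (intro sum.cong refl) (simp add: joint_def eq power2_eq_square algebra_simps)
  then have "mult_sq N (joint K s s) + mult_sq N (joint K t t) - 2 * mult_sq N (joint K s t) \<ge> 2"
    unfolding mult_sq_def using one_le_sum_sq_diff[of "{..N}" r "count (snd s)" "count (snd t)"] r rN by simp
  moreover have "sum_sq (joint K s s) + sum_sq (joint K t t) - 2 * sum_sq (joint K s t) = 0"
    unfolding sum_sq_gap by (simp add: eq)
  then have "(real N + 1) ^ 3 * (sum_sq (joint K s s) + sum_sq (joint K t t) - 2 * sum_sq (joint K s t)) = 0"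
    by simp
  ultimately show ?thesis unfolding weight_def by (simp add: algebra_simps)
qed

section \<open>Points of the dual cone from points of \<open>T_cone 2\<close>\<close>

lemma sub_dom_image_midpoint:
  assumes "finite K"
  shows "sub_dom (image_mset (\<lambda>i. f i + f i) (mset_set K) + image_mset (\<lambda>i. g i + g i) (mset_set K))
    (image_mset (\<lambda>i. f i + g i) (mset_set K) + image_mset (\<lambda>i. f i + g i) (mset_set K))"
  using assms
proof (induction K rule: finite_induct)
  case empty
  show ?case by (simp add: sub_dom_refl)
next
  case (insert i K)
  show ?case
    using sub_dom_add[OF sub_dom_midpoint[of "f i" "g i"] insert.IH] insert.hyps
    by (simp add: add_ac mult_2 add_mset_commute)
qed

text \<open>Each variable in \<open>K\<close> contributes a midpoint comparison, and the multisets
  off \<open>K\<close> occur equally often on both sides. This makes every \<open>y\<close> in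
  \<open>T_cone 2\<close> midpoint convex along \<open>joint\<close>.\<close>

lemma sub_dom_joint:
  assumes "finite K"
  shows "sub_dom (joint K s s + joint K t t) (joint K s t + joint K s t)"
proof -
  have "sub_dom ((snd s + snd s + (snd t + snd t)) + (image_mset (\<lambda>i. fst s i + fst s i) (mset_set K)
        + image_mset (\<lambda>i. fst t i + fst t i) (mset_set K)))
     ((snd s + snd s + (snd t + snd t)) + (image_mset (\<lambda>i. fst s i + fst t i) (mset_set K)
        + image_mset (\<lambda>i. fst s i + fst t i) (mset_set K)))"
    by (intro sub_dom_add[OF sub_dom_refl] sub_dom_image_midpoint assms)
  then show ?thesis by (simp only: joint_def add_ac)
qed

text \<open>To the midpoint convexity of \<open>y\<close>, possibly not strict,
  \<open>c * weight\<close> adds a gap of \<open>c\<close> in the exponents; half of it is the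
  logarithm of the margin that \<open>gapped\<close> demands.\<close>

lemma gapped_exp:
  fixes d :: nat
  defines "c \<equiv> 2 * ln (4 * real (profile_bound d))"
  assumes y: "y \<in> T_cone 2 (2 * d)"
  shows "gapped d (\<lambda>\<mu>. if \<mu> \<in> even_partitions (2 * d) then exp (y \<mu> + c * weight (2 * d) \<mu>) else 0)"
  unfolding gapped_def
proof (intro conjI allI impI ballI)
  fix K :: "nat set" and s t :: profile
  assume K: "finite K" and ext: "fst s \<in> extensional K" "fst t \<in> extensional K" and st: "s \<noteq> t"
    and EP: "joint K s s \<in> even_partitions (2 * d)" "joint K t t \<in> even_partitions (2 * d)"
      "joint K s t \<in> even_partitions (2 * d)"
  have R: "real (profile_bound d) \<ge> 1" using profile_bound_pos[of d] by linarith
  then have c: "c \<ge> 0" by (simp add: c_def)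
  let ?e = "\<lambda>\<mu>. y \<mu> + c * weight (2 * d) \<mu>"
  have "2 * y (joint K s t) \<le> y (joint K s s) + y (joint K t t)"
    by (rule T_cone_2_sub_domD[OF y EP sub_dom_joint[OF K]])
  moreover have "c * (2 * weight (2 * d) (joint K s t) + 1)
      \<le> c * (weight (2 * d) (joint K s s) + weight (2 * d) (joint K t t))"
    by (intro mult_left_mono weight_gap K ext st EP c)
  ultimately have le: "ln (4 * real (profile_bound d)) + ?e (joint K s t) \<le> (?e (joint K s s) + ?e (joint K t t)) / 2"
    by (simp add: c_def algebra_simps)
  have "4 * real (profile_bound d) * exp (?e (joint K s t)) = exp (ln (4 * real (profile_bound d)) + ?e (joint K s t))"
    using R by (simp add: exp_add)
  also have "\<dots> \<le> exp ((?e (joint K s s) + ?e (joint K t t)) / 2)" using le by simp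
  also have "\<dots> = sqrt (exp (?e (joint K s s)) * exp (?e (joint K t t)))"
    by (rule real_sqrt_unique[symmetric])
       (simp_all add: power2_eq_square flip: exp_add)
  finally show "4 * real (profile_bound d) * (if joint K s t \<in> even_partitions (2 * d) then exp (?e (joint K s t)) else 0)
    \<le> sqrt ((if joint K s s \<in> even_partitions (2 * d) then exp (?e (joint K s s)) else 0)
        * (if joint K t t \<in> even_partitions (2 * d) then exp (?e (joint K t t)) else 0))"
    using EP by simp
qed auto

text \<open>The constants are fixed before \<open>y\<close>, and only the number \<open>n\<close> of
  variables depends on \<open>y\<close>; so one pair of constants serves all multiples of a point.
  The perturbation by \<open>c * weight\<close> costs at most the factor
  \<open>exp (c * W)\<close>.\<close>

lemma dual_cone_element_near_exp:
  fixes d :: nat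
  obtains c\<^sub>1 c\<^sub>2 :: real where "c\<^sub>1 > 0" "c\<^sub>2 > 0"
    and "\<And>y. y \<in> T_cone 2 (2 * d) \<Longrightarrow> \<exists>x \<in> dual_cone (even_partitions (2 * d)) (B_Sigma (2 * d)).
       \<forall>\<mu> \<in> even_partitions (2 * d). c\<^sub>1 * exp (y \<mu>) \<le> x \<mu> \<and> x \<mu> \<le> c\<^sub>2 * exp (y \<mu>)"
proof
  let ?N = "2 * d" and ?I = "even_partitions (2 * d)"
  define c where "c = 2 * ln (4 * real (profile_bound d))"
  have "real (profile_bound d) \<ge> 1" using profile_bound_pos[of d] by linarith
  then have c: "c \<ge> 0" by (simp add: c_def)
  define W where "W = (\<Sum>\<mu>\<in>?I. weight ?N \<mu>)"
  have W: "weight ?N \<mu> \<le> W" if "\<mu> \<in> ?I" for \<mu>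
    unfolding W_def using that by (intro member_le_sum) (auto simp: weight_nonneg finite_even_partitions)
  show "(1 / 2) ^ ?N > (0 :: real)" by simp
  show "exp (c * W) * real (?N + 1) ^ ?N > 0" by simp
  fix y assume y: "y \<in> T_cone 2 ?N"
  define g where "g \<mu> = (if \<mu> \<in> ?I then exp (y \<mu> + c * weight ?N \<mu>) else 0)" for \<mu>
  have g: "gapped d g" using gapped_exp[OF y] unfolding g_def c_def .
  define G where "G = (\<Sum>\<mu>\<in>?I. g \<mu>)"
  have "g \<mu> \<le> G" if "\<mu> \<in> ?I" for \<mu>
    unfolding G_def using that by (intro member_le_sum) (auto simp: g_def finite_even_partitions)
  moreover have "0 \<le> G" unfolding G_def by (intro sum_nonneg) (simp add: g_def)
  ultimately have G: "\<bar>g \<mu>\<bar> \<le> G" for \<mu> by (cases "\<mu> \<in> ?I") (auto simp: g_def)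
  define gm where "gm = Min (insert 1 (g ` ?I))"
  have gm: "gm > 0" "\<And>\<mu>. \<mu> \<in> ?I \<Longrightarrow> gm \<le> g \<mu>"
    using finite_even_partitions[of ?N] by (auto simp: gm_def g_def)
  \<comment> \<open>Enough variables for the error of \<open>gram_approx\<close> to fall below the
    tolerance in \<open>gram_form_nonneg\<close>.\<close>
  obtain n0 :: nat where n0: "2 ^ d * G * (4 * real (profile_bound d)) / gm \<le> real n0"
    using real_arch_simple by blast
  define n where "n = max n0 (2 * ?N + 1)"
  have n: "n \<ge> 2 * ?N" "n \<ge> 1" "n \<ge> ?N" "n > 0" by (auto simp: n_def)
  have "2 ^ d * G * (4 * real (profile_bound d)) / gm \<le> real n" using n0 by (simp add: n_def)
  then have large: "2 ^ d * G / real n \<le> gm / (4 * real (profile_bound d))"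
    using gm(1) n(4) profile_bound_pos[of d] by (simp add: field_simps)
  define h where "h e = g (shape e) / real n ^ card (Poly_Mapping.keys e)" for e
  define x where "x = (\<lambda>\<mu>\<in>?I. functional h (power_sum_partition n \<mu>))"
  have "0 \<le> (\<Sum>\<mu>\<in>?I. a \<mu> * x \<mu>)" if a: "a \<in> B_Sigma ?N" for a
  proof -
    let ?f = "\<Sum>\<mu>\<in>?I. Const (a \<mu>) * power_sum_partition n \<mu>"
    obtain qs where qs: "set qs \<subseteq> polys_in n" "?f = (\<Sum>q\<leftarrow>qs. q ^ 2)"
      using a n(3) by (auto simp: B_Sigma_def sum_of_squares_def)
    have "homogeneous (2 * d) (Const (a \<mu>) * power_sum_partition n \<mu>)" if "\<mu> \<in> ?I" for \<mu>
      using homogeneous_mult[OF homogeneous_Const[of "a \<mu>"] homogeneous_power_sum_partition[of \<mu> n]] that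
      by (simp add: even_partitions_def partitions_def)
    then have "homogeneous (2 * d) (\<Sum>q\<leftarrow>qs. q ^ 2)"
      unfolding qs(2)[symmetric] by (rule homogeneous_sum)
    then have hom: "homogeneous d q" if "q \<in> set qs" for q using that by (rule homogeneous_sum_of_squares)
    have "0 \<le> functional h (q ^ 2)" if "q \<in> set qs" for q
      unfolding h_def using that qs(1) by (intro functional_square_nonneg[OF g n(4) G gm large]) (auto intro: hom)
    then have "0 \<le> (\<Sum>q\<leftarrow>qs. functional h (q ^ 2))" by (intro sum_list_nonneg) auto
    also have "\<dots> = functional h ?f" by (simp add: qs(2) functional_sum_list)
    also have "\<dots> = (\<Sum>\<mu>\<in>?I. a \<mu> * x \<mu>)"
      by (simp add: functional_sum functional_Const_mult x_def)
    finally show ?thesis .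
  qed
  then have "x \<in> dual_cone ?I (B_Sigma ?N)" by (simp add: dual_cone_def x_def)
  moreover have "(1 / 2) ^ ?N * exp (y \<mu>) \<le> x \<mu> \<and> x \<mu> \<le> exp (c * W) * real (?N + 1) ^ ?N * exp (y \<mu>)"
    if \<mu>: "\<mu> \<in> ?I" for \<mu>
  proof -
    have size: "size \<mu> \<le> ?N"
      using size_le_sum_mset[of \<mu>] \<mu> by (auto simp: even_partitions_def partitions_def)
    have hb: "1 * exp (y (shape e)) / real n ^ card (Poly_Mapping.keys e) \<le> h e
        \<and> h e \<le> exp (c * W) * exp (y (shape e)) / real n ^ card (Poly_Mapping.keys e)" if e: "shape e \<in> ?I" for e
    proof -
      have "exp (y (shape e)) \<le> g (shape e)" using e c by (simp add: g_def weight_nonneg)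
      moreover have "g (shape e) \<le> exp (c * W) * exp (y (shape e))"
        using e mult_left_mono[OF W[OF e] c] by (simp add: g_def flip: exp_add)
      ultimately show ?thesis unfolding h_def by (simp add: divide_right_mono)
    qed
    \<comment> \<open>The bounds are applied at the monomial 1, whose exponent 0 has empty
      shape.\<close>
    have "1 * (1 / 2) ^ size \<mu> * exp (y (shape 0 + \<mu>)) / real n ^ card (Poly_Mapping.keys (0 :: nat \<Rightarrow>\<^sub>0 nat))
           \<le> functional h (Poly_Mapping.single 0 1 * power_sum_partition n \<mu>)
       \<and> functional h (Poly_Mapping.single 0 1 * power_sum_partition n \<mu>)
           \<le> exp (c * W) * real (?N + 1) ^ size \<mu> * exp (y (shape 0 + \<mu>)) / real n ^ card (Poly_Mapping.keys (0 :: nat \<Rightarrow>\<^sub>0 nat))"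
      by (rule functional_power_sum_partition_bounds[where Y = "\<lambda>\<mu>. exp (y \<mu>)"])
         (use n hb \<mu> T_cone_2_merge[OF y] in auto)
    then have b: "(1 / 2) ^ size \<mu> * exp (y \<mu>) \<le> x \<mu>"
      "x \<mu> \<le> exp (c * W) * real (?N + 1) ^ size \<mu> * exp (y \<mu>)"
      using \<mu> by (simp_all add: x_def)
    have "(1 / 2) ^ ?N * exp (y \<mu>) \<le> (1 / 2) ^ size \<mu> * exp (y \<mu>)"
      using size by (intro mult_right_mono power_decreasing) auto
    moreover have "exp (c * W) * real (?N + 1) ^ size \<mu> * exp (y \<mu>) \<le> exp (c * W) * real (?N + 1) ^ ?N * exp (y \<mu>)"
      using size by (intro mult_right_mono mult_left_mono power_increasing) auto
    ultimately show ?thesis using b by linarith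
  qed
  ultimately show "\<exists>x \<in> dual_cone ?I (B_Sigma ?N). \<forall>\<mu> \<in> ?I. (1 / 2) ^ ?N * exp (y \<mu>) \<le> x \<mu>
      \<and> x \<mu> \<le> exp (c * W) * real (?N + 1) ^ ?N * exp (y \<mu>)"
    by blast
qed

section \<open>Passage to the tropical limit\<close>

lemma T_cone_scale:
  assumes y: "y \<in> T_cone k N" and a: "0 \<le> a"
  shows "(\<lambda>\<mu>\<in>even_partitions N. a * y \<mu>) \<in> T_cone k N"
  unfolding T_cone_def
proof (intro CollectI conjI ballI impI)
  fix \<nu> \<mu> assume \<nu>: "\<nu> \<in> {1..k} \<rightarrow> even_partitions N" and \<mu>: "\<mu> \<in> even_partitions N"
    and dom: "(\<Sum>i = 1..k. \<nu> i) \<succeq>\<^sub>s repeat_mset k \<mu>"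
  have "real k * y \<mu> \<le> (\<Sum>i = 1..k. y (\<nu> i))" using y \<nu> \<mu> dom by (auto simp: T_cone_def)
  then have "a * (real k * y \<mu>) \<le> a * (\<Sum>i = 1..k. y (\<nu> i))" using a by (rule mult_left_mono)
  also have "\<dots> = (\<Sum>i = 1..k. (\<lambda>\<mu>\<in>even_partitions N. a * y \<mu>) (\<nu> i))"
    unfolding sum_distrib_left using \<nu> by (intro sum.cong) auto
  finally show "real k * (\<lambda>\<mu>\<in>even_partitions N. a * y \<mu>) \<mu>
      \<le> (\<Sum>i = 1..k. (\<lambda>\<mu>\<in>even_partitions N. a * y \<mu>) (\<nu> i))"
    using \<mu> by (simp add: mult_ac)
qed simp

text \<open>The multiples \<open>(m + 1) y\<close> stay in the cone, and logarithms to the base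
  \<open>e^(m + 1)\<close> divide by \<open>m + 1\<close>; the constants then contribute terms
  \<open>ln c / (m + 1)\<close>, which tend to 0.\<close>

lemma T_cone_2_subset_trop:
  "T_cone 2 (2 * d) \<subseteq> trop (even_partitions (2 * d)) (dual_cone (even_partitions (2 * d)) (B_Sigma (2 * d)))"
proof
  let ?I = "even_partitions (2 * d)" and ?D = "dual_cone (even_partitions (2 * d)) (B_Sigma (2 * d))"
  fix y assume y: "y \<in> T_cone 2 (2 * d)"
  obtain c\<^sub>1 c\<^sub>2 :: real where c: "c\<^sub>1 > 0" "c\<^sub>2 > 0"
    and near: "\<And>y. y \<in> T_cone 2 (2 * d) \<Longrightarrow> \<exists>x \<in> ?D. \<forall>\<mu> \<in> ?I. c\<^sub>1 * exp (y \<mu>) \<le> x \<mu> \<and> x \<mu> \<le> c\<^sub>2 * exp (y \<mu>)"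
    by (rule dual_cone_element_near_exp[of d]) (rule that)
  have "\<exists>x \<in> ?D. \<forall>\<mu> \<in> ?I. c\<^sub>1 * exp (real (Suc m) * y \<mu>) \<le> x \<mu> \<and> x \<mu> \<le> c\<^sub>2 * exp (real (Suc m) * y \<mu>)" for m
    using near[OF T_cone_scale[OF y, of "real (Suc m)"]] by simp
  then obtain x where x: "\<And>m. x m \<in> ?D"
    "\<And>m \<mu>. \<mu> \<in> ?I \<Longrightarrow> c\<^sub>1 * exp (real (Suc m) * y \<mu>) \<le> x m \<mu> \<and> x m \<mu> \<le> c\<^sub>2 * exp (real (Suc m) * y \<mu>)"
    by metis
  \<comment> \<open>The shift by one keeps the base \<open>1 / \<tau> m\<close> above 1 also for
    \<open>m = 0\<close>.\<close>
  define \<tau> where "\<tau> m = exp (- real (Suc m))" for m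
  have pos: "x m \<mu> > 0" if "\<mu> \<in> ?I" for m \<mu>
    using x(2)[OF that, of m] c(1) by (meson exp_gt_zero less_le_trans mult_pos_pos)
  have lim: "(\<lambda>m. log (1 / \<tau> m) (x m \<mu>)) \<longlonglongrightarrow> y \<mu>" if \<mu>: "\<mu> \<in> ?I" for \<mu>
  proof (rule real_tendsto_sandwich)
    have lg: "log (1 / \<tau> m) (x m \<mu>) = ln (x m \<mu>) / real (Suc m)" for m
    proof -
      have "1 / \<tau> m = exp (real (Suc m))" by (simp only: \<tau>_def exp_minus inverse_eq_divide) simp
      then show ?thesis by (simp only: log_def ln_exp)
    qed
    have bounds: "y \<mu> + ln c\<^sub>1 / real (Suc m) \<le> log (1 / \<tau> m) (x m \<mu>)
        \<and> log (1 / \<tau> m) (x m \<mu>) \<le> y \<mu> + ln c\<^sub>2 / real (Suc m)" for m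
    proof -
      have "ln (c\<^sub>1 * exp (real (Suc m) * y \<mu>)) \<le> ln (x m \<mu>)"
        using x(2)[OF \<mu>, of m] c by (intro ln_mono) auto
      moreover have "ln (x m \<mu>) \<le> ln (c\<^sub>2 * exp (real (Suc m) * y \<mu>))"
        using x(2)[OF \<mu>, of m] pos[OF \<mu>] by (intro ln_mono) auto
      ultimately have "ln c\<^sub>1 + real (Suc m) * y \<mu> \<le> ln (x m \<mu>)" "ln (x m \<mu>) \<le> ln c\<^sub>2 + real (Suc m) * y \<mu>"
        using c by (simp_all add: ln_mult)
      moreover have "y \<mu> + a / real (Suc m) = (a + real (Suc m) * y \<mu>) / real (Suc m)" for a
        by (simp add: add_divide_distrib del: of_nat_Suc)
      ultimately show ?thesis unfolding lg by (simp add: divide_right_mono del: of_nat_Suc)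
    qed
    show "\<forall>\<^sub>F m in sequentially. y \<mu> + ln c\<^sub>1 / real (Suc m) \<le> log (1 / \<tau> m) (x m \<mu>)"
      "\<forall>\<^sub>F m in sequentially. log (1 / \<tau> m) (x m \<mu>) \<le> y \<mu> + ln c\<^sub>2 / real (Suc m)"
      using bounds by (simp_all add: always_eventually)
    have "(\<lambda>m. y \<mu> + a / real (Suc m)) \<longlonglongrightarrow> y \<mu> + 0" for a
      by (intro tendsto_add tendsto_const LIMSEQ_Suc[OF lim_const_over_n])
    then show "(\<lambda>m. y \<mu> + ln c\<^sub>1 / real (Suc m)) \<longlonglongrightarrow> y \<mu>" "(\<lambda>m. y \<mu> + ln c\<^sub>2 / real (Suc m)) \<longlonglongrightarrow> y \<mu>"
      by simp_all
  qed
  have "(\<lambda>m. exp (- 1) ^ Suc m :: real) \<longlonglongrightarrow> 0"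
    by (intro LIMSEQ_Suc LIMSEQ_power_zero) simp
  moreover have "exp (- 1) ^ Suc m = \<tau> m" for m
    unfolding \<tau>_def exp_of_nat_mult[symmetric] by simp
  ultimately have "\<tau> \<longlonglongrightarrow> 0" by (simp only:)
  moreover have "0 < \<tau> m \<and> \<tau> m < 1" for m by (simp add: \<tau>_def)
  moreover have "y \<in> ?I \<rightarrow>\<^sub>E UNIV" using y by (simp add: T_cone_def)
  ultimately show "y \<in> trop ?I ?D"
    unfolding trop_def using x(1) pos lim by blast
qed

theorem proposition5p20:
  fixes d :: nat
  assumes "d \<ge> 1"
  shows "trop (even_partitions (2 * d))
             (dual_cone (even_partitions (2 * d)) (B_Sigma (2 * d))) \<subseteq> T_cone 1 (2 * d)
       \<and> T_cone 2 (2 * d) \<subseteq> trop (even_partitions (2 * d))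
             (dual_cone (even_partitions (2 * d)) (B_Sigma (2 * d)))"
  using trop_subset_T_cone_1[of "2 * d"] T_cone_2_subset_trop[of d] by blast

end
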